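(* Let $\mathcal M$ be a type II$_1$ factor with tracial state $\tau$. If $\mathcal G(\mathcal M)<1/4$, then $\mathcal M$ is singly generated.
   Context: All von Neumann algebras act on a separable complex Hilbert space. A von Neumann algebra is singly generated if it is generated, as a von Neumann algebra, by two self-adjoint elements (equivalently, by a single element). Definition of $\mathcal G$. Let $\mathcal M$ be a diffuse von Neumann algebra (i.e. without minimal projections) with a faithful normal tracial state $\tau$. For each integer $k\ge 1$ let $\mathfrak E_k$ be the collection of all families $\{p_j\}_{j=1}^k$ of mutually orthogonal projections of $\mathcal M$ with $\tau(p_j)=1/k$ for all $j$. For $x\in\mathcal M$ and $\{p_j\}_{j=1}^k\in\mathfrak E_k$ put $\mathcal I(x;\{p_j\}_{j=1}^k)=|\{(i,j): 1\le i,j\le k,\ p_ixp_j\ne 0\}|/k^2$, and for $x_1,\dots,x_n\in\mathcal M$ put $\mathcal I(x_1,\dots,x_n;\{p_j\}_{j=1}^k)=\sum_{m=1}^n\mathcal I(x_m;\{p_j\}_{j=1}^k)$. Let $\mathcal I(x_1,\dots,x_n;k)$ be the infimum of $\mathcal I(x_1,\dots,x_n;\{p_j\}_{j=1}^k)$ over $\{p_j\}_{j=1}^k\in\mathfrak E_k$. Let $\mathcal G(\mathcal M;k)$ be the infimum of $\mathcal I(x_1,\dots,x_n;k)$ over all finite families $x_1,\dots,x_n$ ($n\ge 1$) generating $\mathcal M$ as a von Neumann algebra, and $\mathcal G(\mathcal M;k)=\infty$ if $\mathcal M$ is not finitely generated. Finally $\mathcal G(\mathcal M)=\liminf_{k\to\infty}\mathcal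 G(\mathcal M;k)$. *)

theory Defs
  imports "HOL-Analysis.Analysis"
begin

section \<open>Complex Hilbert spaces and their bounded operators\<close>

text \<open>
  A complex Hilbert space is rendered as a complete real inner product space with a compatible
  complex structure: the real inner product is the real part of the complex one, which is linear
  in its first argument. Positive definiteness, norm and topology come from \<^class>\<open>real_inner\<close>.
\<close>

class complex_hilbert_space = real_inner + complete_space +
  fixes scaleC :: "complex \<Rightarrow> 'a \<Rightarrow> 'a"  (infixr "*\<^sub>C" 75)
    and cinner :: "'a \<Rightarrow> 'a \<Rightarrow> complex"
  assumes scaleC_add_right: "a *\<^sub>C (x + y) = a *\<^sub>C x + a *\<^sub>C y"
    and scaleC_add_left: "(a + b) *\<^sub>C x = a *\<^sub>C x + b *\<^sub>C x"
    and scaleC_scaleC: "a *\<^sub>C (b *\<^sub>C x) = (a * b) *\<^sub>C x"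
    and scaleC_of_real: "complex_of_real r *\<^sub>C x = r *\<^sub>R x"
    and cinner_commute: "cinner x y = cnj (cinner y x)"
    and cinner_add_left: "cinner (x + y) z = cinner x z + cinner y z"
    and cinner_scaleC_left: "cinner (a *\<^sub>C x) y = a * cinner x y"
    and Re_cinner: "Re (cinner x y) = inner x y"

lemma norm_scaleC: "norm (a *\<^sub>C (x::'h::complex_hilbert_space)) = cmod a * norm x"
proof -
  have "cinner (a *\<^sub>C x) (a *\<^sub>C x) = a * cnj a * cinner x x"
    by (metis cinner_commute cinner_scaleC_left complex_cnj_mult mult.assoc)
  then have "inner (a *\<^sub>C x) (a *\<^sub>C x) = (cmod a)\<^sup>2 * inner x x"
    by (simp flip: Re_cinner complex_norm_square)
  then show ?thesis
    by (simp add: norm_eq_sqrt_inner real_sqrt_mult)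
qed

text \<open>
  The library type \<^typ>\<open>'h \<Rightarrow>\<^sub>L 'h\<close> consists of the real-linear bounded operators, so $B(H)$ is
  a subset of it.
\<close>

type_synonym 'h operator = "'h \<Rightarrow>\<^sub>L 'h"

definition bounded_operators :: "'h::complex_hilbert_space operator set" where
  "bounded_operators = {T. \<forall>c x. blinfun_apply T (c *\<^sub>C x) = c *\<^sub>C blinfun_apply T x}"

definition scalar_op :: "complex \<Rightarrow> 'h::complex_hilbert_space operator" where
  "scalar_op c = Blinfun (\<lambda>x. c *\<^sub>C x)"

lemma scalar_op_apply [simp]: "blinfun_apply (scalar_op c) x = c *\<^sub>C x"
proof -
  have "bounded_linear (\<lambda>x::'a. c *\<^sub>C x)"
    by (rule bounded_linear_intro[where K = "cmod c"])
      (auto simp: scaleC_add_right norm_scaleC scaleC_scaleC mult.commute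
        simp flip: scaleC_of_real)
  then show ?thesis
    by (simp add: scalar_op_def bounded_linear_Blinfun_apply)
qed

definition adjoint_op :: "'h::complex_hilbert_space operator \<Rightarrow> 'h operator" where
  "adjoint_op T =
    (THE S. \<forall>x y. cinner (blinfun_apply S x) y = cinner x (blinfun_apply T y))"

definition self_adjoint :: "'h::complex_hilbert_space operator \<Rightarrow> bool" where
  "self_adjoint T \<longleftrightarrow> T \<in> bounded_operators \<and> adjoint_op T = T"

text \<open>The usual order, meaningful for self-adjoint operators.\<close>

definition op_le :: "'h::complex_hilbert_space operator \<Rightarrow> 'h operator \<Rightarrow> bool" where
  "op_le S T \<longleftrightarrow>
    (\<forall>x. Re (cinner (blinfun_apply S x) x) \<le> Re (cinner (blinfun_apply T x) x))"

section \<open>Von Neumann algebras\<close>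

definition commutant :: "'h::complex_hilbert_space operator set \<Rightarrow> 'h operator set" where
  "commutant S = {T \<in> bounded_operators. \<forall>A\<in>S. T o\<^sub>L A = A o\<^sub>L T}"

text \<open>
  A self-adjoint set of bounded operators that equals its bicommutant; it is then automatically
  a unital *-subalgebra of $B(H)$.
\<close>

definition von_neumann_algebra :: "'h::complex_hilbert_space operator set \<Rightarrow> bool" where
  "von_neumann_algebra M \<longleftrightarrow>
    M \<subseteq> bounded_operators \<and> (\<forall>T\<in>M. adjoint_op T \<in> M) \<and> commutant (commutant M) = M"

definition vn_generated :: "'h::complex_hilbert_space operator set \<Rightarrow> 'h operator set" where
  "vn_generated S = \<Inter>{N. von_neumann_algebra N \<and> S \<subseteq> N}"

definition singly_generated :: "'h::complex_hilbert_space operator set \<Rightarrow> bool" where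
  "singly_generated M \<longleftrightarrow>
    (\<exists>a\<in>M. \<exists>b\<in>M. self_adjoint a \<and> self_adjoint b \<and> vn_generated {a, b} = M)"

definition projections :: "'h::complex_hilbert_space operator set \<Rightarrow> 'h operator set" where
  "projections M = {p \<in> M. self_adjoint p \<and> p o\<^sub>L p = p}"

definition minimal_projection ::
    "'h::complex_hilbert_space operator set \<Rightarrow> 'h operator \<Rightarrow> bool" where
  "minimal_projection M p \<longleftrightarrow>
    p \<in> projections M \<and> p \<noteq> 0 \<and> (\<forall>q\<in>projections M. op_le q p \<longrightarrow> q = 0 \<or> q = p)"

definition diffuse :: "'h::complex_hilbert_space operator set \<Rightarrow> bool" where
  "diffuse M \<longleftrightarrow> (\<nexists>p. minimal_projection M p)"

definition murray_von_neumann_equiv ::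
    "'h::complex_hilbert_space operator set \<Rightarrow> 'h operator \<Rightarrow> 'h operator \<Rightarrow> bool" where
  "murray_von_neumann_equiv M p q \<longleftrightarrow>
    (\<exists>v\<in>M. adjoint_op v o\<^sub>L v = p \<and> v o\<^sub>L adjoint_op v = q)"

definition finite_projection ::
    "'h::complex_hilbert_space operator set \<Rightarrow> 'h operator \<Rightarrow> bool" where
  "finite_projection M p \<longleftrightarrow> p \<in> projections M \<and>
    (\<forall>q\<in>projections M. op_le q p \<and> murray_von_neumann_equiv M p q \<longrightarrow> q = p)"

text \<open>The condition $1 \neq 0$ excludes the zero Hilbert space.\<close>

definition factor :: "'h::complex_hilbert_space operator set \<Rightarrow> bool" where
  "factor M \<longleftrightarrow> von_neumann_algebra M \<and> (id_blinfun :: 'h operator) \<noteq> 0 \<and>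
    M \<inter> commutant M = range scalar_op"

definition type_II1_factor :: "'h::complex_hilbert_space operator set \<Rightarrow> bool" where
  "type_II1_factor M \<longleftrightarrow> factor M \<and> diffuse M \<and> finite_projection M id_blinfun"

section \<open>Faithful normal tracial states\<close>

definition tracial_state ::
    "'h::complex_hilbert_space operator set \<Rightarrow> ('h operator \<Rightarrow> complex) \<Rightarrow> bool" where
  "tracial_state M \<tau> \<longleftrightarrow>
    (\<forall>x\<in>M. \<forall>y\<in>M. \<tau> (x + y) = \<tau> x + \<tau> y) \<and>
    (\<forall>c. \<forall>x\<in>M. \<tau> (scalar_op c o\<^sub>L x) = c * \<tau> x) \<and>
    (\<forall>x\<in>M. \<tau> (adjoint_op x o\<^sub>L x) \<in> \<real> \<and> Re (\<tau> (adjoint_op x o\<^sub>L x)) \<ge> 0) \<and>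
    \<tau> id_blinfun = 1 \<and>
    (\<forall>x\<in>M. \<forall>y\<in>M. \<tau> (x o\<^sub>L y) = \<tau> (y o\<^sub>L x))"

definition faithful_on ::
    "'h::complex_hilbert_space operator set \<Rightarrow> ('h operator \<Rightarrow> complex) \<Rightarrow> bool" where
  "faithful_on M \<tau> \<longleftrightarrow> (\<forall>x\<in>M. \<tau> (adjoint_op x o\<^sub>L x) = 0 \<longrightarrow> x = 0)"

definition self_adjoint_part :: "'h::complex_hilbert_space operator set \<Rightarrow> 'h operator set" where
  "self_adjoint_part M = {x \<in> M. self_adjoint x}"

definition is_sup_in ::
    "'h::complex_hilbert_space operator set \<Rightarrow> 'h operator set \<Rightarrow> 'h operator \<Rightarrow> bool" where
  "is_sup_in M D x \<longleftrightarrow> x \<in> self_adjoint_part M \<and> (\<forall>d\<in>D. op_le d x) \<and>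
    (\<forall>y\<in>self_adjoint_part M. (\<forall>d\<in>D. op_le d y) \<longrightarrow> op_le x y)"

text \<open>
  Normality, i.e. preservation of suprema of increasing nets; a net is replaced by its range,
  an upward directed set. For positive \<open>\<tau>\<close> the values on \<open>D\<close> are real and bounded
  above by \<open>\<tau> x\<close>, so the supremum below is a genuine one.
\<close>

definition normal_on ::
    "'h::complex_hilbert_space operator set \<Rightarrow> ('h operator \<Rightarrow> complex) \<Rightarrow> bool" where
  "normal_on M \<tau> \<longleftrightarrow>
    (\<forall>D x. D \<noteq> {} \<and> D \<subseteq> self_adjoint_part M \<and>
       (\<forall>a\<in>D. \<forall>b\<in>D. \<exists>c\<in>D. op_le a c \<and> op_le b c) \<and> is_sup_in M D x
       \<longrightarrow> Re (\<tau> x) = (SUP d\<in>D. Re (\<tau> d)))"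

definition faithful_normal_tracial_state ::
    "'h::complex_hilbert_space operator set \<Rightarrow> ('h operator \<Rightarrow> complex) \<Rightarrow> bool" where
  "faithful_normal_tracial_state M \<tau> \<longleftrightarrow> tracial_state M \<tau> \<and> faithful_on M \<tau> \<and> normal_on M \<tau>"

section \<open>The invariant $\mathcal G$\<close>

text \<open>Families are indexed by \<open>{1..k}\<close>; values outside this range are irrelevant.\<close>

definition equal_families ::
    "'h::complex_hilbert_space operator set \<Rightarrow> ('h operator \<Rightarrow> complex) \<Rightarrow> nat
      \<Rightarrow> (nat \<Rightarrow> 'h operator) set" where
  "equal_families M \<tau> k = {p.
    (\<forall>j\<in>{1..k}. p j \<in> projections M \<and> \<tau> (p j) = 1 / of_nat k) \<and>
    (\<forall>i\<in>{1..k}. \<forall>j\<in>{1..k}. i \<noteq> j \<longrightarrow> p i o\<^sub>L p j = 0)}"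

definition cell_density ::
    "nat \<Rightarrow> (nat \<Rightarrow> 'h::complex_hilbert_space operator) \<Rightarrow> 'h operator \<Rightarrow> real" where
  "cell_density k p x =
    real (card {(i, j). i \<in> {1..k} \<and> j \<in> {1..k} \<and> p i o\<^sub>L x o\<^sub>L p j \<noteq> 0}) / (real k)\<^sup>2"

definition family_density ::
    "nat \<Rightarrow> (nat \<Rightarrow> 'h::complex_hilbert_space operator) \<Rightarrow> 'h operator list \<Rightarrow> real" where
  "family_density k p xs = (\<Sum>x\<leftarrow>xs. cell_density k p x)"

definition min_density ::
    "'h::complex_hilbert_space operator set \<Rightarrow> ('h operator \<Rightarrow> complex) \<Rightarrow> nat
      \<Rightarrow> 'h operator list \<Rightarrow> ereal" where
  "min_density M \<tau> k xs = (INF p\<in>equal_families M \<tau> k. ereal (family_density k p xs))"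

definition generating_families ::
    "'h::complex_hilbert_space operator set \<Rightarrow> 'h operator list set" where
  "generating_families M = {xs. xs \<noteq> [] \<and> set xs \<subseteq> M \<and> vn_generated (set xs) = M}"

text \<open>
  The infimum of the empty set in \<^typ>\<open>ereal\<close> is \<open>\<infinity>\<close>, so the value is \<open>\<infinity>\<close> if \<open>M\<close> is not
  finitely generated.
\<close>

definition G_level ::
    "'h::complex_hilbert_space operator set \<Rightarrow> ('h operator \<Rightarrow> complex) \<Rightarrow> nat \<Rightarrow> ereal" where
  "G_level M \<tau> k = (INF xs\<in>generating_families M. min_density M \<tau> k xs)"

definition G_invariant ::
    "'h::complex_hilbert_space operator set \<Rightarrow> ('h operator \<Rightarrow> complex) \<Rightarrow> ereal" where
  "G_invariant M \<tau> = liminf (\<lambda>k. G_level M \<tau> k)"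

end

theory Submission imports Defs begin

text \<open>
  Since \<open>\<G> M < 1/4\<close>, there are arbitrarily large \<open>k\<close>, projections \<open>p 1, \<dots>, p k\<close> of trace \<open>1/k\<close> with
  sum 1, and generators of \<open>M\<close> that together have fewer than \<open>k\<^sup>2/4\<close> nonzero blocks \<open>p i x p j\<close>. The
  strictly upper triangular part of a \<open>k\<close> by \<open>k\<close> block matrix has \<open>k(k-1)/2\<close> positions, enough to
  store all these blocks, and also elements connecting the \<open>p j\<close>, in the upper triangle of one
  self-adjoint operator \<open>b\<close>. The diagonal operator \<open>a\<close> with entries \<open>1, \<dots>, k\<close> separates the positions
  of \<open>b\<close> again, so \<open>a\<close> and \<open>b\<close> generate every block and hence \<open>M\<close>
  (\<open>blocks_from_two_self_adjoints\<close>).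

  To store the block at \<open>(i, j)\<close> in another position \<open>(s, t)\<close>, it must be transported there by
  elements that can be undone. Matrix units would do, but they need the polar decomposition.
  Instead the first row of \<open>b\<close> contains, at position \<open>(1, j)\<close>, a quasi-affinity \<open>c j\<close> in
  \<open>p 1 M p j\<close>, that is, \<open>c j\<close> and its adjoint are injective on the ranges of \<open>p j\<close> and \<open>p 1\<close>. A
  block \<open>z\<close> is stored as \<open>(c s)\<^sup>* (c i) z (c j)\<^sup>* (c t)\<close>. An operator commuting with this product and
  with all \<open>c j\<close> and their adjoints commutes with \<open>z\<close>, because the outer factors can be cancelled
  (\<open>cancel_quasi_affinities\<close>); the bicommutant property finishes the argument. The rows below the
  first have \<open>(k-1)(k-2)/2\<close> positions, at least \<open>k\<^sup>2/4\<close> once \<open>k \<ge> 6\<close>.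

  Quasi-affinities between projections of equal trace (\<open>quasi_affinity_exists\<close>) come from a maximal
  family of elements with orthogonal supports, which exhausts both projections because \<open>M\<close> is a
  factor (\<open>factor_prime\<close>) and because the kernel projections of \<open>y\<close> and of its adjoint have
  the same trace (\<open>kernel_projections_same_trace\<close>). Adjoints and orthogonal projections are
  obtained from a minimisation argument in Hilbert space (\<open>riesz_on_closed_subspace\<close>).
\<close>

section \<open>Adjoints and orthogonal projections\<close>

text \<open>
  The Riesz representation, relative to a closed subspace: \<open>v\<close> minimises the strictly convex
  functional \<open>x \<mapsto> (norm x)\<^sup>2 - 2 * \<phi> x\<close> on \<open>K\<close>, and a minimising sequence is Cauchy by the
  parallelogram law. For \<open>K = UNIV\<close> this gives adjoints, for \<open>\<phi> = inner h\<close> the orthogonal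
  projection of \<open>h\<close> to \<open>K\<close>.
\<close>

lemma riesz_on_closed_subspace:
  fixes K :: "'a::{real_inner, complete_space} set"
  assumes "subspace K" "closed K" "bounded_linear \<phi>"
  shows "\<exists>v\<in>K. \<forall>x\<in>K. inner v x = \<phi> x"
proof -
  interpret \<phi>: bounded_linear \<phi> by fact
  define J where "J x = (norm x)\<^sup>2 - 2 * \<phi> x" for x
  obtain B where B: "\<And>x. norm (\<phi> x) \<le> norm x * B"
    using \<phi>.bounded by blast
  have J_lower: "- B\<^sup>2 \<le> J x" for x
  proof -
    have "\<phi> x \<le> norm x * B"
      using B[of x] by simp
    moreover have "0 \<le> (norm x - B)\<^sup>2"
      by simp
    ultimately show ?thesis
      unfolding J_def by (simp add: power2_diff)
  qed
  define m where "m = Inf (J ` K)"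
  have bdd: "bdd_below (J ` K)"
    using J_lower by (auto intro: bdd_belowI[of _ "- B\<^sup>2"])
  have ne: "J ` K \<noteq> {}"
    using assms(1) subspace_0 by auto
  have m_le: "m \<le> J x" if "x \<in> K" for x
    unfolding m_def using bdd that by (simp add: cInf_lower)
  have "\<exists>x\<in>K. J x < m + 1 / real (Suc n)" for n
  proof -
    have "Inf (J ` K) < m + 1 / real (Suc n)"
      by (simp add: m_def)
    then show ?thesis
      using cInf_lessD[OF ne] by blast
  qed
  then obtain X where X: "\<And>n. X n \<in> K" "\<And>n. J (X n) < m + 1 / real (Suc n)"
    by metis
  have parallelogram: "(norm (x - y))\<^sup>2 \<le> 2 * (J x + J y - 2 * m)" if "x \<in> K" "y \<in> K" for x y
  proof -
    let ?z = "(1/2) *\<^sub>R (x + y)"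
    have "?z \<in> K"
      using assms(1) that by (simp add: subspace_add subspace_scale)
    from m_le[OF this] have "m \<le> (norm ?z)\<^sup>2 - 2 * \<phi> ?z"
      by (simp add: J_def)
    moreover have "(norm ?z)\<^sup>2 = (norm (x + y))\<^sup>2 / 4"
      by (simp add: power_divide)
    moreover have "\<phi> ?z = (\<phi> x + \<phi> y) / 2"
      by (simp only: \<phi>.scaleR \<phi>.add) simp
    moreover have "(norm (x + y))\<^sup>2 + (norm (x - y))\<^sup>2 = 2 * (norm x)\<^sup>2 + 2 * (norm y)\<^sup>2"
      by (simp add: power2_norm_eq_inner inner_add inner_diff inner_commute)
    ultimately show ?thesis
      unfolding J_def by (simp add: field_simps)
  qed
  have "Cauchy X"
  proof (rule metric_CauchyI)
    fix e :: real assume "0 < e"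
    then have "0 < e\<^sup>2 / 4"
      by simp
    then obtain N where N: "inverse (real (Suc N)) < e\<^sup>2 / 4"
      using reals_Archimedean by blast
    have small: "J (X n) < m + e\<^sup>2 / 4" if "N \<le> n" for n
    proof -
      have "1 / real (Suc n) \<le> inverse (real (Suc N))"
        using that by (simp add: field_simps)
      then show ?thesis
        using N X(2)[of n] by linarith
    qed
    have halves: "a \<le> 2 * (b + c - 2 * m) \<Longrightarrow> b < m + d / 4 \<Longrightarrow> c < m + d / 4 \<Longrightarrow> a < d" for a b c d :: real
      by (simp add: field_simps)
    have "dist (X i) (X j) < e" if "N \<le> i" "N \<le> j" for i j
    proof -
      have "(norm (X i - X j))\<^sup>2 < e\<^sup>2"
        using parallelogram[OF X(1) X(1), of i j] small[OF that(1)] small[OF that(2)]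
        by (rule halves)
      then show ?thesis
        using \<open>0 < e\<close> by (simp add: dist_norm power2_less_imp_less)
    qed
    then show "\<exists>M. \<forall>i\<ge>M. \<forall>j\<ge>M. dist (X i) (X j) < e"
      by blast
  qed
  then obtain v where v: "X \<longlonglongrightarrow> v"
    using Cauchy_convergent convergent_def by blast
  have "v \<in> K"
    using assms(2) X(1) v closed_sequentially by blast
  have "J v \<le> m"
  proof (rule LIMSEQ_le)
    show "(\<lambda>n. J (X n)) \<longlonglongrightarrow> J v"
      unfolding J_def by (intro tendsto_intros \<phi>.tendsto v)
    show "(\<lambda>n. m + inverse (real (Suc n))) \<longlonglongrightarrow> m"
      using tendsto_add[OF tendsto_const[of m] LIMSEQ_inverse_real_of_nat] by simp
    show "\<exists>N. \<forall>n\<ge>N. J (X n) \<le> m + inverse (real (Suc n))"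
      using X(2) by (auto simp: inverse_eq_divide intro: less_imp_le)
  qed
  have "inner v x = \<phi> x" if "x \<in> K" for x
  proof -
    define c where "c = inner v x - \<phi> x"
    have quad: "0 \<le> t\<^sup>2 * (norm x)\<^sup>2 + 2 * t * c" for t
    proof -
      have "v + t *\<^sub>R x \<in> K"
        using assms(1) that \<open>v \<in> K\<close> by (simp add: subspace_add subspace_scale)
      then have "J v \<le> J (v + t *\<^sub>R x)"
        using m_le \<open>J v \<le> m\<close> by force
      moreover have "(norm (v + t *\<^sub>R x))\<^sup>2 = (norm v)\<^sup>2 + t\<^sup>2 * (norm x)\<^sup>2 + 2 * t * inner v x"
        unfolding power2_norm_eq_inner
        by (simp add: inner_add inner_commute power2_eq_square algebra_simps)
      ultimately show ?thesis
        unfolding J_def c_def by (simp add: \<phi>.add \<phi>.scaleR algebra_simps)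
    qed
    \<comment> \<open>Evaluating the quadratic at \<open>t = - c / (1 + (norm x)\<^sup>2)\<close> makes it negative unless \<open>c = 0\<close>.\<close>
    define s where "s = 1 + (norm x)\<^sup>2"
    have "0 < s"
      by (simp add: s_def add_pos_nonneg)
    have "0 \<le> (- c / s)\<^sup>2 * (s - 1) + 2 * (- c / s) * c"
      using quad[of "- c / s"] by (simp add: s_def)
    also have "\<dots> = - (c\<^sup>2 / s) - c\<^sup>2 / s\<^sup>2"
      using \<open>0 < s\<close> by (simp add: power2_eq_square field_simps)
    finally have "c\<^sup>2 / s \<le> 0"
      by (smt (verit) divide_nonneg_nonneg zero_le_power2)
    then have "c = 0"
      using \<open>0 < s\<close> by (simp add: divide_le_0_iff)
    then show ?thesis
      by (simp add: c_def)
  qed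
  with \<open>v \<in> K\<close> show ?thesis
    by blast
qed

lemma eq_if_inner_eq: "(\<And>y. inner x y = inner z y) \<Longrightarrow> x = (z::'a::real_inner)"
  using vector_eq_rdot by blast

lemma inner_scaleC_left: "inner (c *\<^sub>C x) y = inner x (cnj c *\<^sub>C (y::'h::complex_hilbert_space))"
proof -
  have "cinner (c *\<^sub>C x) y = cinner x (cnj c *\<^sub>C y)"
    by (metis cinner_commute cinner_scaleC_left complex_cnj_cnj complex_cnj_mult)
  then show ?thesis
    by (metis Re_cinner)
qed

text \<open>The real inner product determines the complex one, so adjoints can be tested on it.\<close>

lemma cinner_eq_inner: "cinner x y = Complex (inner x y) (- inner (\<i> *\<^sub>C x) (y::'h::complex_hilbert_space))"
proof -
  have "inner (\<i> *\<^sub>C x) y = Re (\<i> * cinner x y)"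
    by (metis Re_cinner cinner_scaleC_left)
  then show ?thesis
    by (simp add: complex_eq_iff Re_cinner)
qed

lemma bounded_operatorsD: "T \<in> bounded_operators \<Longrightarrow> blinfun_apply T (c *\<^sub>C x) = c *\<^sub>C blinfun_apply T x"
  by (simp add: bounded_operators_def)

lemma adjoint_op_eqI:
  fixes T S :: "'h::complex_hilbert_space operator"
  assumes "T \<in> bounded_operators" "\<And>x y. inner (blinfun_apply S x) y = inner x (blinfun_apply T y)"
  shows "S \<in> bounded_operators" "adjoint_op T = S"
proof -
  have scale: "blinfun_apply S (c *\<^sub>C x) = c *\<^sub>C blinfun_apply S x" for c x
  proof -
    have "inner (blinfun_apply S (c *\<^sub>C x)) y = inner (c *\<^sub>C blinfun_apply S x) y" for y
      using assms by (simp add: inner_scaleC_left bounded_operatorsD)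
    then show ?thesis
      by (rule eq_if_inner_eq)
  qed
  then show "S \<in> bounded_operators"
    by (simp add: bounded_operators_def)
  have "cinner (blinfun_apply S x) y = cinner x (blinfun_apply T y)" for x y
    unfolding cinner_eq_inner using assms(2) by (simp flip: scale)
  moreover have "S' = S" if "\<forall>x y. cinner (blinfun_apply S' x) y = cinner x (blinfun_apply T y)" for S'
  proof (rule blinfun_eqI)
    fix x
    have "inner (blinfun_apply S' x) y = inner (blinfun_apply S x) y" for y
      using that assms(2) by (metis Re_cinner)
    then show "blinfun_apply S' x = blinfun_apply S x"
      by (rule eq_if_inner_eq)
  qed
  ultimately show "adjoint_op T = S"
    unfolding adjoint_op_def by (intro the_equality) auto
qed

lemma adjoint_op_exists:
  fixes T :: "'h::complex_hilbert_space operator"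
  shows "\<exists>S::'h operator. \<forall>x y. inner (blinfun_apply S x) y = inner x (blinfun_apply T y)"
proof -
  have "\<exists>v. \<forall>y. inner v y = inner x (blinfun_apply T y)" for x
  proof -
    have "bounded_linear (\<lambda>y. inner x (blinfun_apply T y))"
      by (intro bounded_linear_intros)
    then show ?thesis
      using riesz_on_closed_subspace[of UNIV "\<lambda>y. inner x (blinfun_apply T y)"] by auto
  qed
  then obtain S where S: "\<And>x y. inner (S x) y = inner x (blinfun_apply T y)"
    by metis
  have "bounded_linear S"
  proof (rule bounded_linear_intro[where K = "norm T"])
    show "S (x + y) = S x + S y" for x y
      by (rule eq_if_inner_eq) (simp add: S inner_add_left)
    show "S (r *\<^sub>R x) = r *\<^sub>R S x" for r x
      by (rule eq_if_inner_eq) (simp add: S)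
    show "norm (S x) \<le> norm x * norm T" for x
    proof (cases "S x = 0")
      case False
      have "(norm (S x))\<^sup>2 = inner x (blinfun_apply T (S x))"
        by (simp add: power2_norm_eq_inner S)
      also have "\<dots> \<le> norm x * norm (blinfun_apply T (S x))"
        by (rule norm_cauchy_schwarz)
      also have "\<dots> \<le> norm x * (norm T * norm (S x))"
        by (intro mult_left_mono norm_blinfun) auto
      finally show ?thesis
        using False by (simp add: power2_eq_square mult.assoc[symmetric])
    qed simp
  qed
  then have "\<forall>x y. inner (blinfun_apply (Blinfun S) x) y = inner x (blinfun_apply T y)"
    by (simp add: bounded_linear_Blinfun_apply S)
  then show ?thesis
    by blast
qed

lemma
  assumes "T \<in> bounded_operators"
  shows adjoint_op_left: "inner (blinfun_apply (adjoint_op T) x) y = inner x (blinfun_apply T y)"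
    and adjoint_op_right: "inner x (blinfun_apply (adjoint_op T) y) = inner (blinfun_apply T x) y"
    and adjoint_op_bounded_operators: "adjoint_op T \<in> bounded_operators"
proof -
  obtain S where S: "\<And>x y. inner (blinfun_apply S x) y = inner x (blinfun_apply T y)"
    using adjoint_op_exists by blast
  note * = adjoint_op_eqI[OF assms S]
  show left: "inner (blinfun_apply (adjoint_op T) x) y = inner x (blinfun_apply T y)" for x y
    by (simp add: * S)
  show "inner x (blinfun_apply (adjoint_op T) y) = inner (blinfun_apply T x) y"
    using left[of y x] by (simp add: inner_commute)
  show "adjoint_op T \<in> bounded_operators"
    by (simp add: *)
qed

lemma bounded_operators_compose:
  "S \<in> bounded_operators \<Longrightarrow> T \<in> bounded_operators \<Longrightarrow> S o\<^sub>L T \<in> bounded_operators"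
  by (simp add: bounded_operators_def)

lemma bounded_operators_add:
  "S \<in> bounded_operators \<Longrightarrow> T \<in> bounded_operators \<Longrightarrow> S + T \<in> bounded_operators"
  by (simp add: bounded_operators_def blinfun.add_left scaleC_add_right)

lemma adjoint_op_adjoint_op: "T \<in> bounded_operators \<Longrightarrow> adjoint_op (adjoint_op T) = T"
  by (rule adjoint_op_eqI(2)) (simp_all add: adjoint_op_bounded_operators adjoint_op_right)

lemma adjoint_op_compose:
  "S \<in> bounded_operators \<Longrightarrow> T \<in> bounded_operators \<Longrightarrow>
    adjoint_op (S o\<^sub>L T) = adjoint_op T o\<^sub>L adjoint_op S"
  by (rule adjoint_op_eqI(2)) (simp_all add: bounded_operators_compose adjoint_op_left)

lemma adjoint_op_add:
  "S \<in> bounded_operators \<Longrightarrow> T \<in> bounded_operators \<Longrightarrow> adjoint_op (S + T) = adjoint_op S + adjoint_op T"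
  by (rule adjoint_op_eqI(2))
    (simp_all add: bounded_operators_add adjoint_op_left blinfun.add_left inner_add)

lemma self_adjoint_iff:
  "self_adjoint T \<longleftrightarrow> T \<in> bounded_operators \<and>
    (\<forall>x y. inner (blinfun_apply T x) y = inner x (blinfun_apply T y))"
  unfolding self_adjoint_def by (metis adjoint_op_eqI(2) adjoint_op_left)

lemma orthogonal_projection_exists:
  fixes K :: "'h::complex_hilbert_space set"
  assumes "subspace K" "closed K" "\<And>c x. x \<in> K \<Longrightarrow> c *\<^sub>C x \<in> K"
  shows "\<exists>P. self_adjoint P \<and> P o\<^sub>L P = P \<and> (\<forall>x. blinfun_apply P x \<in> K) \<and>
    (\<forall>x\<in>K. blinfun_apply P x = x)"
proof -
  have "\<exists>v\<in>K. \<forall>x\<in>K. inner v x = inner h x" for h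
    using riesz_on_closed_subspace[OF assms(1,2) bounded_linear_inner_right] .
  then obtain f where f: "\<And>h. f h \<in> K" "\<And>h x. x \<in> K \<Longrightarrow> inner (f h) x = inner h x"
    by metis
  have unique: "f h = v" if "v \<in> K" "\<And>x. x \<in> K \<Longrightarrow> inner v x = inner h x" for h v
  proof -
    have "f h - v \<in> K"
      using assms(1) f(1) that(1) by (simp add: subspace_diff)
    then have "inner (f h - v) (f h - v) = 0"
      using f(2) that(2) by (metis inner_diff_left right_minus_eq)
    then show ?thesis
      by simp
  qed
  have "bounded_linear f"
  proof (rule bounded_linear_intro[where K = 1])
    show "f (x + y) = f x + f y" for x y
      by (rule unique) (simp_all add: f inner_add_left assms(1) subspace_add)
    show "f (r *\<^sub>R x) = r *\<^sub>R f x" for r x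
      by (rule unique) (simp_all add: f assms(1) subspace_scale)
    show "norm (f x) \<le> norm x * 1" for x
    proof (cases "f x = 0")
      case False
      have "(norm (f x))\<^sup>2 = inner x (f x)"
        by (simp add: power2_norm_eq_inner f)
      also have "\<dots> \<le> norm x * norm (f x)"
        by (rule norm_cauchy_schwarz)
      finally show ?thesis
        using False by (simp add: power2_eq_square)
    qed simp
  qed
  then have P: "blinfun_apply (Blinfun f) = f"
    by (rule bounded_linear_Blinfun_apply)
  have f_fixed: "f x = x" if "x \<in> K" for x
    using that by (intro unique) auto
  have "f (c *\<^sub>C x) = c *\<^sub>C f x" for c x
    by (rule unique) (simp_all add: f assms(3) inner_scaleC_left)
  moreover have "inner (f x) y = inner x (f y)" for x y
    by (metis f inner_commute)
  moreover have "Blinfun f o\<^sub>L Blinfun f = Blinfun f"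
    by (rule blinfun_eqI) (simp add: P f_fixed f(1))
  ultimately show ?thesis
    by (intro exI[of _ "Blinfun f"]) (auto simp: self_adjoint_iff bounded_operators_def P f_fixed f)
qed

section \<open>Operations inside a von Neumann algebra\<close>

lemma blinfun_compose_assoc: "(a o\<^sub>L b) o\<^sub>L c = a o\<^sub>L (b o\<^sub>L c)"
  by (rule blinfun_eqI) simp

lemmas compose_add_left = bounded_bilinear.add_left[OF bounded_bilinear_blinfun_compose]
lemmas compose_add_right = bounded_bilinear.add_right[OF bounded_bilinear_blinfun_compose]
lemmas compose_diff_left = bounded_bilinear.diff_left[OF bounded_bilinear_blinfun_compose]
lemmas compose_diff_right = bounded_bilinear.diff_right[OF bounded_bilinear_blinfun_compose]
lemmas compose_sum_left = bounded_bilinear.sum_left[OF bounded_bilinear_blinfun_compose]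
lemmas compose_sum_right = bounded_bilinear.sum_right[OF bounded_bilinear_blinfun_compose]
lemmas compose_scaleR_left = bounded_bilinear.scaleR_left[OF bounded_bilinear_blinfun_compose]
lemmas compose_scaleR_right = bounded_bilinear.scaleR_right[OF bounded_bilinear_blinfun_compose]

lemma compose_id [simp]: "id_blinfun o\<^sub>L a = a" "a o\<^sub>L id_blinfun = a"
  by (auto intro: blinfun_eqI)

lemma scalar_op_of_real: "scalar_op (complex_of_real r) o\<^sub>L x = r *\<^sub>R x"
  by (rule blinfun_eqI) (simp add: scaleC_of_real scaleR_blinfun.rep_eq)

lemma scaleC_0_right [simp]: "c *\<^sub>C (0::'h::complex_hilbert_space) = 0"
  by (metis add_cancel_right_right scaleC_add_right)

lemma scaleR_scaleC_commute: "c *\<^sub>C r *\<^sub>R x = r *\<^sub>R c *\<^sub>C (x::'h::complex_hilbert_space)"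
  by (metis mult.commute scaleC_of_real scaleC_scaleC)

lemma scaleC_minus_right: "c *\<^sub>C (- x) = - (c *\<^sub>C (x::'h::complex_hilbert_space))"
  using scaleR_scaleC_commute[of c "-1" x] by simp

lemma bounded_operators_diff:
  "S \<in> bounded_operators \<Longrightarrow> T \<in> bounded_operators \<Longrightarrow> S - T \<in> bounded_operators"
  using scaleC_add_right[of _ "_ :: 'a" "- _"]
  by (simp add: bounded_operators_def blinfun.diff_left scaleC_minus_right)

lemma
  assumes "S \<subseteq> bounded_operators"
  shows commutant_id: "id_blinfun \<in> commutant S"
    and commutant_0: "0 \<in> commutant S"
    and commutant_add: "x \<in> commutant S \<Longrightarrow> y \<in> commutant S \<Longrightarrow> x + y \<in> commutant S"
    and commutant_compose: "x \<in> commutant S \<Longrightarrow> y \<in> commutant S \<Longrightarrow> x o\<^sub>L y \<in> commutant S"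
    and commutant_scaleR: "x \<in> commutant S \<Longrightarrow> r *\<^sub>R x \<in> commutant S"
proof -
  show "id_blinfun \<in> commutant S" "0 \<in> commutant S"
    by (auto simp: commutant_def bounded_operators_def)
  show "x + y \<in> commutant S" if "x \<in> commutant S" "y \<in> commutant S"
    using that by (auto simp: commutant_def bounded_operators_add compose_add_left compose_add_right)
  show "x o\<^sub>L y \<in> commutant S" if "x \<in> commutant S" "y \<in> commutant S"
    using that by (auto simp: commutant_def bounded_operators_compose blinfun_compose_assoc)
      (metis blinfun_compose_assoc)
  show "r *\<^sub>R x \<in> commutant S" if "x \<in> commutant S"
    using that by (auto simp: commutant_def compose_scaleR_left compose_scaleR_right
        bounded_operators_def scaleR_blinfun.rep_eq scaleR_scaleC_commute)
qed

lemma commutant_strong_limit: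
  fixes S :: "'h::complex_hilbert_space operator set"
  assumes "\<And>n. X n \<in> commutant S"
    and lim: "\<And>h. (\<lambda>n. blinfun_apply (X n) h) \<longlonglongrightarrow> blinfun_apply L h"
  shows "L \<in> commutant S"
proof -
  have scale: "blinfun_apply L (c *\<^sub>C h) = c *\<^sub>C blinfun_apply L h" for c h
  proof (rule LIMSEQ_unique)
    show "(\<lambda>n. blinfun_apply (X n) (c *\<^sub>C h)) \<longlonglongrightarrow> blinfun_apply L (c *\<^sub>C h)"
      by (rule lim)
    have "(\<lambda>n. blinfun_apply (scalar_op c) (blinfun_apply (X n) h)) \<longlonglongrightarrow>
        blinfun_apply (scalar_op c) (blinfun_apply L h)"
      by (intro blinfun.tendsto tendsto_const lim)
    then show "(\<lambda>n. blinfun_apply (X n) (c *\<^sub>C h)) \<longlonglongrightarrow> c *\<^sub>C blinfun_apply L h"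
      using assms(1) by (simp add: commutant_def bounded_operators_def)
  qed
  have "L o\<^sub>L A = A o\<^sub>L L" if "A \<in> S" for A
  proof (rule blinfun_eqI)
    fix h
    have "blinfun_apply (X n) (blinfun_apply A h) = blinfun_apply A (blinfun_apply (X n) h)" for n
      using assms(1)[of n] that by (metis (mono_tags, lifting) blinfun_apply_blinfun_compose commutant_def mem_Collect_eq)
    moreover have "(\<lambda>n. blinfun_apply A (blinfun_apply (X n) h)) \<longlonglongrightarrow> blinfun_apply A (blinfun_apply L h)"
      by (intro blinfun.tendsto tendsto_const lim)
    ultimately show "blinfun_apply (L o\<^sub>L A) h = blinfun_apply (A o\<^sub>L L) h"
      using lim[of "blinfun_apply A h"] LIMSEQ_unique by fastforce
  qed
  then show ?thesis
    by (simp add: commutant_def bounded_operators_def scale)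
qed

locale von_neumann =
  fixes M :: "'h::complex_hilbert_space operator set"
  assumes vN: "von_neumann_algebra M"
begin

lemma bicommutant: "commutant (commutant M) = M"
  using vN by (simp add: von_neumann_algebra_def)

lemma bounded [simp]: "x \<in> M \<Longrightarrow> x \<in> bounded_operators"
  using vN by (auto simp: von_neumann_algebra_def)

lemma adjoint_closed [simp]: "x \<in> M \<Longrightarrow> adjoint_op x \<in> M"
  using vN by (auto simp: von_neumann_algebra_def)

lemma commutant_bounded: "commutant M \<subseteq> bounded_operators"
  by (auto simp: commutant_def)

lemma id_closed [simp]: "id_blinfun \<in> M"
  using commutant_id[OF commutant_bounded] by (simp add: bicommutant)

lemma zero_closed [simp]: "0 \<in> M"
  using commutant_0[OF commutant_bounded] by (simp add: bicommutant)

lemma add_closed [simp]: "x \<in> M \<Longrightarrow> y \<in> M \<Longrightarrow> x + y \<in> M"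
  using commutant_add[OF commutant_bounded] by (simp add: bicommutant)

lemma compose_closed [simp]: "x \<in> M \<Longrightarrow> y \<in> M \<Longrightarrow> x o\<^sub>L y \<in> M"
  using commutant_compose[OF commutant_bounded] by (simp add: bicommutant)

lemma scaleR_closed [simp]: "x \<in> M \<Longrightarrow> r *\<^sub>R x \<in> M"
  using commutant_scaleR[OF commutant_bounded] by (simp add: bicommutant)

lemma diff_closed [simp]: "x \<in> M \<Longrightarrow> y \<in> M \<Longrightarrow> x - y \<in> M"
  using add_closed[OF _ scaleR_closed[of y "-1"], of x] by simp

lemma uminus_closed [simp]: "x \<in> M \<Longrightarrow> - x \<in> M"
  using scaleR_closed[of x "-1"] by simp

lemma sum_closed: "(\<And>i. i \<in> I \<Longrightarrow> f i \<in> M) \<Longrightarrow> (\<Sum>i\<in>I. f i) \<in> M"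
  by (induction I rule: infinite_finite_induct) auto

lemma strong_limit_closed:
  assumes "\<And>n. X n \<in> M" "\<And>h. (\<lambda>n. blinfun_apply (X n) h) \<longlonglongrightarrow> blinfun_apply L h"
  shows "L \<in> M"
  using commutant_strong_limit[of X "commutant M" L] assms by (simp add: bicommutant)

lemma adjoint_left: "x \<in> M \<Longrightarrow> inner (blinfun_apply (adjoint_op x) h) k = inner h (blinfun_apply x k)"
  by (simp add: adjoint_op_left)

lemma adjoint_right: "x \<in> M \<Longrightarrow> inner h (blinfun_apply (adjoint_op x) k) = inner (blinfun_apply x h) k"
  by (simp add: adjoint_op_right)

lemma adjoint_adjoint [simp]: "x \<in> M \<Longrightarrow> adjoint_op (adjoint_op x) = x"
  by (simp add: adjoint_op_adjoint_op)

lemma adjoint_compose: "x \<in> M \<Longrightarrow> y \<in> M \<Longrightarrow> adjoint_op (x o\<^sub>L y) = adjoint_op y o\<^sub>L adjoint_op x"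
  by (simp add: adjoint_op_compose)

lemma adjoint_add: "x \<in> M \<Longrightarrow> y \<in> M \<Longrightarrow> adjoint_op (x + y) = adjoint_op x + adjoint_op y"
  by (simp add: adjoint_op_add)

lemma adjoint_eqI:
  "x \<in> M \<Longrightarrow> (\<And>h k. inner (blinfun_apply y h) k = inner h (blinfun_apply x k)) \<Longrightarrow> adjoint_op x = y"
  by (rule adjoint_op_eqI(2)) auto

lemma adjoint_zero [simp]: "adjoint_op 0 = (0 :: 'h operator)"
  by (rule adjoint_eqI) auto

lemma adjoint_scaleR: "x \<in> M \<Longrightarrow> adjoint_op (r *\<^sub>R x) = r *\<^sub>R adjoint_op x"
  by (rule adjoint_eqI) (auto simp: scaleR_blinfun.rep_eq adjoint_left)

lemma adjoint_sum:
  "(\<And>i. i \<in> I \<Longrightarrow> f i \<in> M) \<Longrightarrow> adjoint_op (\<Sum>i\<in>I. f i) = (\<Sum>i\<in>I. adjoint_op (f i))"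
  by (induction I rule: infinite_finite_induct) (auto simp: adjoint_add sum_closed)

lemma commutes_with_commutant:
  "x \<in> M \<Longrightarrow> T \<in> commutant M \<Longrightarrow> blinfun_apply T (blinfun_apply x h) = blinfun_apply x (blinfun_apply T h)"
  by (metis (mono_tags, lifting) blinfun_apply_blinfun_compose commutant_def mem_Collect_eq)

lemma projectionsD:
  assumes "p \<in> projections M"
  shows "p \<in> M" "adjoint_op p = p" "p o\<^sub>L p = p" "blinfun_apply p (blinfun_apply p h) = blinfun_apply p h"
    "inner (blinfun_apply p h) k = inner h (blinfun_apply p k)"
proof -
  show *: "p \<in> M" "adjoint_op p = p" "p o\<^sub>L p = p"
    using assms by (auto simp: projections_def self_adjoint_def)
  show "blinfun_apply p (blinfun_apply p h) = blinfun_apply p h"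
    by (metis *(3) blinfun_apply_blinfun_compose)
  show "inner (blinfun_apply p h) k = inner h (blinfun_apply p k)"
    using * by (metis adjoint_left)
qed

lemma projectionsI: "x \<in> M \<Longrightarrow> adjoint_op x = x \<Longrightarrow> x o\<^sub>L x = x \<Longrightarrow> x \<in> projections M"
  by (simp add: projections_def self_adjoint_def)

lemma adjoint_absorb_left:
  "q \<in> projections M \<Longrightarrow> x \<in> M \<Longrightarrow> x o\<^sub>L q = x \<Longrightarrow> q o\<^sub>L adjoint_op x = adjoint_op x"
  by (metis adjoint_compose projectionsD(1,2))

lemma adjoint_absorb_right:
  "q \<in> projections M \<Longrightarrow> x \<in> M \<Longrightarrow> q o\<^sub>L x = x \<Longrightarrow> adjoint_op x o\<^sub>L q = adjoint_op x"
  by (metis adjoint_compose projectionsD(1,2))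

lemma projections_complement: "p \<in> projections M \<Longrightarrow> id_blinfun - p \<in> projections M"
  unfolding projections_def self_adjoint_iff
  by (auto simp: compose_diff_left compose_diff_right blinfun.diff_left inner_diff)

lemma adjoint_compose_eq_0:
  "x \<in> M \<Longrightarrow> y \<in> M \<Longrightarrow> x o\<^sub>L y = 0 \<Longrightarrow> adjoint_op y o\<^sub>L adjoint_op x = 0"
  by (metis adjoint_compose adjoint_zero)

end

section \<open>Kernel projections as limits of powers\<close>

primrec op_power :: "'h::real_normed_vector operator \<Rightarrow> nat \<Rightarrow> 'h operator" where
  "op_power b 0 = id_blinfun"
| "op_power b (Suc n) = b o\<^sub>L op_power b n"

lemma op_power_apply: "blinfun_apply (op_power b n) h = (blinfun_apply b ^^ n) h"
  by (induction n) auto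

lemma funpow_self_adjoint:
  assumes "self_adjoint b"
  shows "inner ((blinfun_apply b ^^ i) h) k = inner h ((blinfun_apply b ^^ i) k)"
proof (induction i arbitrary: k)
  case (Suc i)
  have "inner ((blinfun_apply b ^^ Suc i) h) k = inner ((blinfun_apply b ^^ i) h) (blinfun_apply b k)"
    using assms by (simp add: self_adjoint_iff)
  also have "\<dots> = inner h ((blinfun_apply b ^^ Suc i) k)"
    by (simp add: Suc funpow_swap1)
  finally show ?case .
qed simp

lemma strong_limit_exists:
  fixes X :: "nat \<Rightarrow> 'a::real_normed_vector \<Rightarrow>\<^sub>L 'b::real_normed_vector"
  assumes "\<And>n h. norm (blinfun_apply (X n) h) \<le> norm h"
    and "\<And>h. convergent (\<lambda>n. blinfun_apply (X n) h)"
  shows "\<exists>L. \<forall>h. (\<lambda>n. blinfun_apply (X n) h) \<longlonglongrightarrow> blinfun_apply L h"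
proof -
  define f where "f h = lim (\<lambda>n. blinfun_apply (X n) h)" for h
  have lim: "(\<lambda>n. blinfun_apply (X n) h) \<longlonglongrightarrow> f h" for h
    using assms(2) by (simp add: f_def convergent_LIMSEQ_iff)
  have "bounded_linear f"
  proof (rule bounded_linear_intro[where K = 1])
    show "f (x + y) = f x + f y" for x y
      using lim[of "x + y"] tendsto_add[OF lim[of x] lim[of y]]
      by (simp add: blinfun.add_right LIMSEQ_unique)
    show "f (r *\<^sub>R x) = r *\<^sub>R f x" for r x
      using lim[of "r *\<^sub>R x"] tendsto_scaleR[OF tendsto_const[of r] lim[of x]]
      by (simp add: blinfun.scaleR_right LIMSEQ_unique)
    show "norm (f x) \<le> norm x * 1" for x
      using Lim_bounded[OF tendsto_norm[OF lim[of x]]] assms(1) by simp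
  qed
  then show ?thesis
    using lim by (metis bounded_linear_Blinfun_apply)
qed

context von_neumann
begin

lemma op_power_closed [simp]: "b \<in> M \<Longrightarrow> op_power b n \<in> M"
  by (induction n) auto

text \<open>
  The even powers of a self-adjoint contraction \<open>b\<close> converge strongly because
  \<open>inner (b^(2*m) h) (b^(2*n) h) = (norm (b^(m+n) h))\<^sup>2\<close> decreases in \<open>m + n\<close>; even powers are
  used because they decrease in the operator order. The limit is the projection onto the
  fixed vectors of \<open>b\<^sup>2\<close>.
\<close>

lemma even_powers_limit:
  assumes "b \<in> M" "self_adjoint b" and contr: "\<And>h. norm (blinfun_apply b h) \<le> norm h"
  shows "\<exists>P\<in>projections M.
    (\<forall>h. (\<lambda>n. blinfun_apply (op_power b (2 * n)) h) \<longlonglongrightarrow> blinfun_apply P h) \<and>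
    (\<forall>h. blinfun_apply P h = h \<longleftrightarrow> blinfun_apply b (blinfun_apply b h) = h)"
proof -
  have sa: "inner (blinfun_apply b h) k = inner h (blinfun_apply b k)" for h k
    using assms(2) by (simp add: self_adjoint_iff)
  note sa_pow = funpow_self_adjoint[OF assms(2)]
  have pow_pow: "inner ((blinfun_apply b ^^ i) h) ((blinfun_apply b ^^ j) h) =
      inner h ((blinfun_apply b ^^ (i + j)) h)" for i j h
    by (simp add: sa_pow funpow_add)
  have norm_pow: "norm ((blinfun_apply b ^^ i) h) \<le> norm h" for i h
    by (induction i) (auto intro: order_trans[OF contr])
  have conv: "convergent (\<lambda>n. blinfun_apply (op_power b (2 * n)) h)" for h
  proof -
    define s where "s j = (norm ((blinfun_apply b ^^ j) h))\<^sup>2" for j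
    have s_even: "inner h ((blinfun_apply b ^^ (2 * j)) h) = s j" for j
      by (simp add: s_def power2_norm_eq_inner pow_pow mult_2)
    have "decseq s"
      unfolding s_def by (intro decseq_SucI power_mono) (auto simp: contr)
    moreover have "0 \<le> s j" for j
      by (simp add: s_def)
    ultimately obtain L where L: "s \<longlonglongrightarrow> L" "\<And>j. L \<le> s j"
      using decseq_convergent[of s 0] by blast
    have diff: "(norm ((blinfun_apply b ^^ (2 * n)) h - (blinfun_apply b ^^ (2 * m)) h))\<^sup>2 =
        s (2 * n) + s (2 * m) - 2 * s (n + m)" for n m
    proof -
      have "inner h ((blinfun_apply b ^^ (2 * n + 2 * m)) h) = s (n + m)"
        using s_even[of "n + m"] by (simp add: distrib_left)
      moreover have "inner h ((blinfun_apply b ^^ (2 * m + 2 * n)) h) = s (n + m)"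
        using s_even[of "n + m"] by (simp add: distrib_left add.commute)
      moreover have "inner h ((blinfun_apply b ^^ (2 * i + 2 * i)) h) = s (2 * i)" for i
        using s_even[of "2 * i"] by (simp add: mult_2)
      ultimately show ?thesis
        unfolding power2_norm_eq_inner inner_diff_left inner_diff_right pow_pow by simp
    qed
    have "Cauchy (\<lambda>n. (blinfun_apply b ^^ (2 * n)) h)"
    proof (rule metric_CauchyI)
      fix e :: real assume "0 < e"
      have halves: "a < L + d / 4 \<Longrightarrow> b < L + d / 4 \<Longrightarrow> L \<le> c \<Longrightarrow> 0 < d \<Longrightarrow> a + b - 2 * c < d" for a b c d :: real
        by simp
      from \<open>0 < e\<close> have "\<forall>\<^sub>F n in sequentially. s n < L + e\<^sup>2 / 4"
        using L(1) by (intro order_tendstoD) auto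
      then obtain N where N: "\<And>n. N \<le> n \<Longrightarrow> s n < L + e\<^sup>2 / 4"
        by (auto simp: eventually_sequentially)
      have "dist ((blinfun_apply b ^^ (2 * i)) h) ((blinfun_apply b ^^ (2 * j)) h) < e"
        if "N \<le> i" "N \<le> j" for i j
      proof -
        have "s (2 * i) < L + e\<^sup>2 / 4" "s (2 * j) < L + e\<^sup>2 / 4"
          using that by (auto intro: N)
        moreover have "L \<le> s (i + j)"
          by (rule L(2))
        moreover have "0 < e\<^sup>2"
          using \<open>0 < e\<close> by simp
        ultimately have "s (2 * i) + s (2 * j) - 2 * s (i + j) < e\<^sup>2"
          by (rule halves)
        then have "(norm ((blinfun_apply b ^^ (2 * i)) h - (blinfun_apply b ^^ (2 * j)) h))\<^sup>2 < e\<^sup>2"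
          by (simp only: diff)
        then show ?thesis
          using \<open>0 < e\<close> by (simp add: dist_norm power2_less_imp_less)
      qed
      then show "\<exists>N. \<forall>i\<ge>N. \<forall>j\<ge>N. dist ((blinfun_apply b ^^ (2 * i)) h) ((blinfun_apply b ^^ (2 * j)) h) < e"
        by blast
    qed
    then show ?thesis
      by (simp add: op_power_apply Cauchy_convergent)
  qed
  obtain P where P: "\<And>h. (\<lambda>n. blinfun_apply (op_power b (2 * n)) h) \<longlonglongrightarrow> blinfun_apply P h"
    using strong_limit_exists[OF norm_pow[of "2 * _", folded op_power_apply] conv] by blast
  have "P \<in> M"
    using strong_limit_closed[OF op_power_closed[OF assms(1)] P] .
  have sa_P: "inner (blinfun_apply P h) k = inner h (blinfun_apply P k)" for h k
  proof (rule LIMSEQ_unique)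
    show "(\<lambda>n. inner (blinfun_apply (op_power b (2 * n)) h) k) \<longlonglongrightarrow> inner (blinfun_apply P h) k"
      by (intro tendsto_intros P)
    have "(\<lambda>n. inner h (blinfun_apply (op_power b (2 * n)) k)) \<longlonglongrightarrow> inner h (blinfun_apply P k)"
      by (intro tendsto_intros P)
    then show "(\<lambda>n. inner (blinfun_apply (op_power b (2 * n)) h) k) \<longlonglongrightarrow> inner h (blinfun_apply P k)"
      by (simp add: op_power_apply sa_pow)
  qed
  have P_fixed: "blinfun_apply b (blinfun_apply b (blinfun_apply P h)) = blinfun_apply P h" for h
  proof (rule LIMSEQ_unique)
    show "(\<lambda>n. blinfun_apply b (blinfun_apply b (blinfun_apply (op_power b (2 * n)) h))) \<longlonglongrightarrow>
        blinfun_apply b (blinfun_apply b (blinfun_apply P h))"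
      by (intro blinfun.tendsto tendsto_const P)
    show "(\<lambda>n. blinfun_apply b (blinfun_apply b (blinfun_apply (op_power b (2 * n)) h))) \<longlonglongrightarrow>
        blinfun_apply P h"
      using LIMSEQ_Suc[OF P[of h]] by simp
  qed
  have fixed_P: "blinfun_apply P h = h" if "blinfun_apply b (blinfun_apply b h) = h" for h
  proof -
    have "(blinfun_apply b ^^ (2 * n)) h = h" for n
      by (induction n) (auto simp: that)
    then have "(\<lambda>n. h) \<longlonglongrightarrow> blinfun_apply P h"
      using P[of h] by (simp add: op_power_apply)
    then show ?thesis
      using LIMSEQ_unique tendsto_const by blast
  qed
  have "P o\<^sub>L P = P"
    by (rule blinfun_eqI) (simp add: fixed_P P_fixed)
  then have "P \<in> projections M"
    using \<open>P \<in> M\<close> sa_P by (simp add: projections_def self_adjoint_iff)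
  moreover have "blinfun_apply P h = h \<longleftrightarrow> blinfun_apply b (blinfun_apply b h) = h" for h
    using P_fixed[of h] fixed_P[of h] by auto
  ultimately show ?thesis
    using P by blast
qed

end

section \<open>The trace of kernel projections\<close>

locale traced_von_neumann = von_neumann M for M :: "'h::complex_hilbert_space operator set" +
  fixes \<tau> :: "'h operator \<Rightarrow> complex"
  assumes trace: "faithful_normal_tracial_state M \<tau>"
begin

abbreviation tr :: "'h operator \<Rightarrow> real" where
  "tr x \<equiv> Re (\<tau> x)"

lemma tr_add: "x \<in> M \<Longrightarrow> y \<in> M \<Longrightarrow> tr (x + y) = tr x + tr y"
  using trace by (simp add: faithful_normal_tracial_state_def tracial_state_def)

lemma tr_scaleR: "x \<in> M \<Longrightarrow> tr (r *\<^sub>R x) = r * tr x"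
proof -
  assume "x \<in> M"
  then have "\<tau> (scalar_op (complex_of_real r) o\<^sub>L x) = complex_of_real r * \<tau> x"
    using trace by (simp add: faithful_normal_tracial_state_def tracial_state_def)
  then show ?thesis
    by (simp add: scalar_op_of_real)
qed

lemma tr_diff: "x \<in> M \<Longrightarrow> y \<in> M \<Longrightarrow> tr (x - y) = tr x - tr y"
  using tr_add[of x "(-1) *\<^sub>R y"] tr_scaleR[of y "-1"] by simp

lemma tr_0 [simp]: "tr 0 = 0"
  using tr_scaleR[of 0 0] by simp

lemma tr_sum: "(\<And>i. i \<in> I \<Longrightarrow> f i \<in> M) \<Longrightarrow> tr (\<Sum>i\<in>I. f i) = (\<Sum>i\<in>I. tr (f i))"
  by (induction I rule: infinite_finite_induct) (auto simp: tr_add sum_closed)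

lemma tr_commute: "x \<in> M \<Longrightarrow> y \<in> M \<Longrightarrow> tr (x o\<^sub>L y) = tr (y o\<^sub>L x)"
  using trace by (simp add: faithful_normal_tracial_state_def tracial_state_def)

lemma tr_id: "tr id_blinfun = 1"
  using trace by (simp add: faithful_normal_tracial_state_def tracial_state_def)

lemma projection_eq_0:
  assumes "p \<in> projections M" "tr p = 0"
  shows "p = 0"
proof -
  note p = projectionsD[OF assms(1)]
  have "\<tau> (adjoint_op p o\<^sub>L p) \<in> \<real>"
    using trace p(1) unfolding faithful_normal_tracial_state_def tracial_state_def by blast
  then have "\<tau> p = 0"
    using assms(2) p(2,3) by (simp add: complex_eq_iff complex_is_Real_iff)
  then show ?thesis
    using trace p by (metis faithful_normal_tracial_state_def faithful_on_def)
qed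

text \<open>
  Normality speaks of suprema of directed sets in the operator order. The strong limit of an
  increasing sequence is such a supremum, since order relations can be tested on vectors.
\<close>

lemma tr_increasing_limit:
  assumes "\<And>n. X n \<in> M" "\<And>n. self_adjoint (X n)"
    and mono: "\<And>n h. inner (blinfun_apply (X n) h) h \<le> inner (blinfun_apply (X (Suc n)) h) h"
    and lim: "\<And>h. (\<lambda>n. blinfun_apply (X n) h) \<longlonglongrightarrow> blinfun_apply L h"
  shows "tr L = (SUP n. tr (X n))"
proof -
  have "L \<in> M"
    using strong_limit_closed assms(1) lim .
  have sa: "inner (blinfun_apply L h) k = inner h (blinfun_apply L k)" for h k
  proof (rule LIMSEQ_unique)
    show "(\<lambda>n. inner (blinfun_apply (X n) h) k) \<longlonglongrightarrow> inner (blinfun_apply L h) k"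
      by (intro tendsto_intros lim)
    have "(\<lambda>n. inner h (blinfun_apply (X n) k)) \<longlonglongrightarrow> inner h (blinfun_apply L k)"
      by (intro tendsto_intros lim)
    then show "(\<lambda>n. inner (blinfun_apply (X n) h) k) \<longlonglongrightarrow> inner h (blinfun_apply L k)"
      using assms(2) by (simp add: self_adjoint_iff)
  qed
  have incseq: "incseq (\<lambda>n. inner (blinfun_apply (X n) h) h)" for h
    by (rule incseq_SucI) (rule mono)
  have lim_inner: "(\<lambda>n. inner (blinfun_apply (X n) h) h) \<longlonglongrightarrow> inner (blinfun_apply L h) h" for h
    by (intro tendsto_intros lim)
  have "L \<in> self_adjoint_part M"
    using \<open>L \<in> M\<close> sa by (simp add: self_adjoint_part_def self_adjoint_iff)
  moreover have "op_le (X n) L" for n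
    using incseq_le[OF incseq lim_inner] by (simp add: op_le_def Re_cinner)
  moreover have "op_le L y" if "\<And>n. op_le (X n) y" for y
    using that LIMSEQ_le_const2[OF lim_inner] by (auto simp: op_le_def Re_cinner)
  ultimately have "is_sup_in M (range X) L"
    by (auto simp: is_sup_in_def)
  moreover have "\<exists>c\<in>range X. op_le a c \<and> op_le b c" if "a \<in> range X" "b \<in> range X" for a b
  proof -
    from that obtain i j where "a = X i" "b = X j"
      by blast
    then have "op_le a (X (max i j)) \<and> op_le b (X (max i j))"
      using incseqD[OF incseq] by (simp add: op_le_def Re_cinner)
    then show ?thesis
      by blast
  qed
  moreover have "range X \<subseteq> self_adjoint_part M"
    using assms(1,2) by (auto simp: self_adjoint_part_def)
  moreover have "normal_on M \<tau>"
    using trace by (simp add: faithful_normal_tracial_state_def)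
  ultimately have "tr L = (SUP d\<in>range X. tr d)"
    unfolding normal_on_def by (metis (no_types, lifting) UNIV_not_empty image_is_empty)
  then show ?thesis
    by (simp add: image_image)
qed

text \<open>
  Since \<open>y\<close> intertwines \<open>1 - y\<^sup>* y\<close> and \<open>1 - y y\<^sup>*\<close>, the trace property moves it past a power of either.
\<close>

lemma tr_power_commute:
  assumes "y \<in> M"
  shows "tr (op_power (id_blinfun - (adjoint_op y o\<^sub>L y)) n) = tr (op_power (id_blinfun - (y o\<^sub>L adjoint_op y)) n)"
proof (induction n)
  case (Suc n)
  let ?b = "id_blinfun - (adjoint_op y o\<^sub>L y)" and ?c = "id_blinfun - (y o\<^sub>L adjoint_op y)"
  have swap: "op_power ?c n o\<^sub>L y = y o\<^sub>L op_power ?b n"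
  proof (induction n)
    case (Suc n)
    have "op_power ?c (Suc n) o\<^sub>L y = ?c o\<^sub>L (y o\<^sub>L op_power ?b n)"
      by (simp add: blinfun_compose_assoc Suc)
    also have "\<dots> = y o\<^sub>L op_power ?b (Suc n)"
      by (simp add: compose_diff_left compose_diff_right blinfun_compose_assoc)
    finally show ?case .
  qed simp
  note [simp] = assms
  have "tr (op_power ?c (Suc n)) = tr (op_power ?c n) - tr (y o\<^sub>L (adjoint_op y o\<^sub>L op_power ?c n))"
    by (simp add: compose_diff_left tr_diff blinfun_compose_assoc)
  also have "tr (y o\<^sub>L (adjoint_op y o\<^sub>L op_power ?c n)) = tr (adjoint_op y o\<^sub>L (op_power ?c n o\<^sub>L y))"
    by (subst tr_commute) (simp_all add: blinfun_compose_assoc)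
  also have "\<dots> = tr (adjoint_op y o\<^sub>L y o\<^sub>L op_power ?b n)"
    by (simp add: swap blinfun_compose_assoc)
  finally show ?case
    using Suc by (simp add: compose_diff_left tr_diff)
qed simp

lemma kernel_projection_contraction:
  assumes "y \<in> M" and contr: "\<And>h. norm (blinfun_apply y h) \<le> norm h"
    and contr': "\<And>h. norm (blinfun_apply (adjoint_op y) h) \<le> norm h"
  shows "\<exists>P\<in>projections M. (\<forall>h. blinfun_apply P h = h \<longleftrightarrow> blinfun_apply y h = 0) \<and>
    - tr P = (SUP n. - tr (op_power (id_blinfun - (adjoint_op y o\<^sub>L y)) (2 * n)))"
proof -
  define b where "b = id_blinfun - (adjoint_op y o\<^sub>L y)"
  have "b \<in> M"
    using assms(1) by (simp add: b_def)
  have sa: "inner (blinfun_apply b h) k = inner h (blinfun_apply b k)" for h k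
    using assms(1) by (simp add: b_def blinfun.diff_left inner_diff adjoint_left adjoint_right)
  then have "self_adjoint b"
    using \<open>b \<in> M\<close> by (simp add: self_adjoint_iff)
  have b_norm: "(norm (blinfun_apply b h))\<^sup>2 \<le> (norm h)\<^sup>2 - (norm (blinfun_apply y h))\<^sup>2" for h
  proof -
    have "(norm (blinfun_apply b h))\<^sup>2 = (norm h)\<^sup>2 - 2 * (norm (blinfun_apply y h))\<^sup>2
        + (norm (blinfun_apply (adjoint_op y) (blinfun_apply y h)))\<^sup>2"
      using assms(1) unfolding power2_norm_eq_inner
      by (simp add: b_def blinfun.diff_left inner_diff adjoint_left adjoint_right)
    moreover have "(norm (blinfun_apply (adjoint_op y) (blinfun_apply y h)))\<^sup>2 \<le> (norm (blinfun_apply y h))\<^sup>2"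
      by (intro power_mono contr') auto
    ultimately show ?thesis
      by linarith
  qed
  have b_contr: "norm (blinfun_apply b h) \<le> norm h" for h
  proof (rule power2_le_imp_le)
    have "0 \<le> (norm (blinfun_apply y h))\<^sup>2"
      by simp
    with b_norm[of h] show "(norm (blinfun_apply b h))\<^sup>2 \<le> (norm h)\<^sup>2"
      by linarith
  qed simp
  have fixed_iff: "blinfun_apply b (blinfun_apply b h) = h \<longleftrightarrow> blinfun_apply y h = 0" for h
  proof
    assume "blinfun_apply b (blinfun_apply b h) = h"
    then have "norm h \<le> norm (blinfun_apply b h)"
      using b_contr[of "blinfun_apply b h"] by simp
    then have "(norm h)\<^sup>2 \<le> (norm (blinfun_apply b h))\<^sup>2"
      by (intro power_mono) auto
    with b_norm[of h] have "(norm (blinfun_apply y h))\<^sup>2 \<le> 0"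
      by linarith
    then show "blinfun_apply y h = 0"
      by simp
  qed (simp add: b_def blinfun.diff_left)
  obtain P where P: "P \<in> projections M"
    "\<And>h. (\<lambda>n. blinfun_apply (op_power b (2 * n)) h) \<longlonglongrightarrow> blinfun_apply P h"
    "\<And>h. blinfun_apply P h = h \<longleftrightarrow> blinfun_apply y h = 0"
    using even_powers_limit[OF \<open>b \<in> M\<close> \<open>self_adjoint b\<close> b_contr] fixed_iff by auto
  note sa_pow = funpow_self_adjoint[OF \<open>self_adjoint b\<close>]
  have "tr (- P) = (SUP n. tr (- op_power b (2 * n)))"
  proof (rule tr_increasing_limit)
    show "- op_power b (2 * n) \<in> M" for n
      using \<open>b \<in> M\<close> by simp
    then show "self_adjoint (- op_power b (2 * n))" for n
      using bounded by (simp add: self_adjoint_iff blinfun.minus_left op_power_apply sa_pow)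
    show "inner (blinfun_apply (- op_power b (2 * n)) h) h \<le>
        inner (blinfun_apply (- op_power b (2 * Suc n)) h) h" for n h
    proof -
      have "inner ((blinfun_apply b ^^ (2 * i)) h) h = (norm ((blinfun_apply b ^^ i) h))\<^sup>2" for i
        by (simp add: power2_norm_eq_inner mult_2 funpow_add sa_pow)
      moreover have "(norm ((blinfun_apply b ^^ Suc n) h))\<^sup>2 \<le> (norm ((blinfun_apply b ^^ n) h))\<^sup>2"
        by (intro power_mono) (auto simp: b_contr)
      ultimately show ?thesis
        by (simp only: op_power_apply blinfun.minus_left inner_minus_left neg_le_iff_le)
    qed
    show "(\<lambda>n. blinfun_apply (- op_power b (2 * n)) h) \<longlonglongrightarrow> blinfun_apply (- P) h" for h
      unfolding blinfun.minus_left by (intro tendsto_minus P)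
  qed
  moreover have "tr (- x) = - tr x" if "x \<in> M" for x
    using tr_scaleR[OF that, of "-1"] by simp
  ultimately show ?thesis
    using P \<open>b \<in> M\<close> by (auto simp: projectionsD b_def intro!: bexI[of _ P])
qed

text \<open>
  In place of the polar decomposition: after rescaling \<open>y\<close> to a contraction, the kernel projections of \<open>y\<close> and
  of its adjoint are the limits of the even powers of \<open>1 - y\<^sup>* y\<close> and of \<open>1 - y y\<^sup>*\<close>. These powers have
  equal traces, and normality carries the equality to the limits.
\<close>

lemma kernel_projections_same_trace:
  assumes "y \<in> M"
  shows "\<exists>P\<in>projections M. \<exists>Q\<in>projections M.
    (\<forall>h. blinfun_apply P h = h \<longleftrightarrow> blinfun_apply y h = 0) \<and>
    (\<forall>h. blinfun_apply Q h = h \<longleftrightarrow> blinfun_apply (adjoint_op y) h = 0) \<and> tr P = tr Q"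
proof -
  define B where "B = 1 + norm y + norm (adjoint_op y)"
  have "0 < B"
    by (simp add: B_def add_pos_nonneg)
  define z where "z = (1 / B) *\<^sub>R y"
  have "z \<in> M"
    using assms by (simp add: z_def)
  have adj_z: "adjoint_op z = (1 / B) *\<^sub>R adjoint_op y"
    using assms by (simp add: z_def adjoint_scaleR)
  have contr: "norm (blinfun_apply ((1 / B) *\<^sub>R x) h) \<le> norm h" if "norm x \<le> B" for x :: "'h operator" and h
  proof -
    have "norm (blinfun_apply x h) \<le> B * norm h"
      using norm_blinfun[of x h] that by (meson mult_right_mono norm_ge_zero order_trans)
    then show ?thesis
      using \<open>0 < B\<close> by (simp add: scaleR_blinfun.rep_eq field_simps)
  qed
  have contr_z: "norm (blinfun_apply z h) \<le> norm h" "norm (blinfun_apply (adjoint_op z) h) \<le> norm h" for h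
    unfolding adj_z unfolding z_def by (rule contr; simp add: B_def)+
  have "\<exists>P\<in>projections M. (\<forall>h. blinfun_apply P h = h \<longleftrightarrow> blinfun_apply z h = 0) \<and>
      - tr P = (SUP n. - tr (op_power (id_blinfun - (adjoint_op z o\<^sub>L z)) (2 * n)))"
    by (rule kernel_projection_contraction) (auto simp: \<open>z \<in> M\<close> contr_z)
  moreover have "\<exists>Q\<in>projections M. (\<forall>h. blinfun_apply Q h = h \<longleftrightarrow> blinfun_apply (adjoint_op z) h = 0) \<and>
      - tr Q = (SUP n. - tr (op_power (id_blinfun - (z o\<^sub>L adjoint_op z)) (2 * n)))"
    using kernel_projection_contraction[of "adjoint_op z"] \<open>z \<in> M\<close> contr_z by simp
  ultimately obtain P Q where "P \<in> projections M" "Q \<in> projections M"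
    "\<And>h. blinfun_apply P h = h \<longleftrightarrow> blinfun_apply z h = 0"
    "\<And>h. blinfun_apply Q h = h \<longleftrightarrow> blinfun_apply (adjoint_op z) h = 0" "tr P = tr Q"
    using tr_power_commute[OF \<open>z \<in> M\<close>] by (metis (no_types, lifting) SUP_cong neg_equal_iff_equal)
  moreover have "blinfun_apply z h = 0 \<longleftrightarrow> blinfun_apply y h = 0"
    "blinfun_apply (adjoint_op z) h = 0 \<longleftrightarrow> blinfun_apply (adjoint_op y) h = 0" for h
    using \<open>0 < B\<close> unfolding adj_z by (simp_all add: z_def scaleR_blinfun.rep_eq)
  ultimately show ?thesis
    by metis
qed

end

section \<open>Quasi-affinities between projections of equal trace\<close>

lemma projection_commutes_if_invariant:
  assumes "self_adjoint P" "\<And>h. blinfun_apply P h \<in> K" "\<And>h. h \<in> K \<Longrightarrow> blinfun_apply P h = h"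
    and "T \<in> bounded_operators"
    and inv: "\<And>h. h \<in> K \<Longrightarrow> blinfun_apply T h \<in> K" "\<And>h. h \<in> K \<Longrightarrow> blinfun_apply (adjoint_op T) h \<in> K"
  shows "P o\<^sub>L T = T o\<^sub>L P"
proof (rule blinfun_eqI)
  fix h
  have sa: "inner (blinfun_apply P h) k = inner h (blinfun_apply P k)" for h k
    using assms(1) by (simp add: self_adjoint_iff)
  have "blinfun_apply P (blinfun_apply T h) = blinfun_apply T (blinfun_apply P h)"
  proof (rule eq_if_inner_eq)
    fix k
    have "inner (blinfun_apply P (blinfun_apply T h)) k = inner h (blinfun_apply (adjoint_op T) (blinfun_apply P k))"
      using assms(4) by (simp add: sa adjoint_op_right)
    also have "\<dots> = inner h (blinfun_apply P (blinfun_apply (adjoint_op T) (blinfun_apply P k)))"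
      by (simp add: assms(2,3) inv(2))
    also have "\<dots> = inner (blinfun_apply P (blinfun_apply T (blinfun_apply P h))) k"
      using assms(4) by (simp add: sa[symmetric] adjoint_op_right)
    also have "\<dots> = inner (blinfun_apply T (blinfun_apply P h)) k"
      by (simp add: assms(2,3) inv(1))
    finally show "inner (blinfun_apply P (blinfun_apply T h)) k = inner (blinfun_apply T (blinfun_apply P h)) k" .
  qed
  then show "blinfun_apply (P o\<^sub>L T) h = blinfun_apply (T o\<^sub>L P) h"
    by simp
qed

context von_neumann
begin

lemma commutant_adjoint_closed:
  assumes "T \<in> commutant M"
  shows "adjoint_op T \<in> commutant M"
proof -
  have T: "T \<in> bounded_operators"
    using assms by (simp add: commutant_def)
  have "adjoint_op T o\<^sub>L A = A o\<^sub>L adjoint_op T" if "A \<in> M" for A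
  proof (rule blinfun_eqI)
    fix h
    have "inner (blinfun_apply (adjoint_op T) (blinfun_apply A h)) k =
        inner (blinfun_apply A (blinfun_apply (adjoint_op T) h)) k" for k
      using that commutes_with_commutant[OF adjoint_closed[OF that] assms, of k]
      by (simp add: adjoint_op_left[OF T] adjoint_right[OF that, symmetric])
    then show "blinfun_apply (adjoint_op T o\<^sub>L A) h = blinfun_apply (A o\<^sub>L adjoint_op T) h"
      by (auto intro: eq_if_inner_eq)
  qed
  then show ?thesis
    using T by (simp add: commutant_def adjoint_op_bounded_operators)
qed

text \<open>
  The vectors \<open>h\<close> with \<open>e (x h) = 0\<close> for every \<open>x\<close> in \<open>M\<close> form a closed subspace invariant under
  both \<open>M\<close> and its commutant. The projection onto it is central, hence 0 or 1.
\<close>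

lemma factor_prime:
  assumes "factor M" "e \<in> M" "f \<in> M" and zero: "\<And>x. x \<in> M \<Longrightarrow> e o\<^sub>L x o\<^sub>L f = 0"
  shows "e = 0 \<or> f = 0"
proof (cases "f = 0")
  case False
  define K where "K = {h. \<forall>x\<in>M. blinfun_apply e (blinfun_apply x h) = 0}"
  have "subspace K"
    by (auto simp: K_def subspace_def blinfun.add_right blinfun.scaleR_right)
  moreover have "closed K"
  proof -
    have "closed {h. blinfun_apply e (blinfun_apply x h) = 0}" for x
      by (intro closed_Collect_eq continuous_intros)
    then have "closed (\<Inter>x\<in>M. {h. blinfun_apply e (blinfun_apply x h) = 0})"
      by blast
    then show ?thesis
      by (simp add: K_def Collect_ball_eq)
  qed
  moreover have "c *\<^sub>C h \<in> K" if "h \<in> K" for c h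
    using that assms(2) by (auto simp: K_def bounded_operatorsD)
  ultimately obtain P where P: "self_adjoint P" "P o\<^sub>L P = P" "\<And>h. blinfun_apply P h \<in> K"
    "\<And>h. h \<in> K \<Longrightarrow> blinfun_apply P h = h"
    using orthogonal_projection_exists[of K] by auto
  have K_M: "blinfun_apply x h \<in> K" if "x \<in> M" "h \<in> K" for x h
  proof -
    have "blinfun_apply e (blinfun_apply (y o\<^sub>L x) h) = 0" if "y \<in> M" for y
      using \<open>h \<in> K\<close> compose_closed[OF that \<open>x \<in> M\<close>] unfolding K_def by blast
    then show ?thesis
      by (simp add: K_def)
  qed
  have K_commutant: "blinfun_apply T h \<in> K" if "T \<in> commutant M" "h \<in> K" for T h
  proof -
    have "blinfun_apply e (blinfun_apply x (blinfun_apply T h)) = 0" if "x \<in> M" for x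
    proof -
      have "blinfun_apply e (blinfun_apply x (blinfun_apply T h)) = blinfun_apply T (blinfun_apply e (blinfun_apply x h))"
        using commutes_with_commutant[OF assms(2) \<open>T \<in> commutant M\<close>]
          commutes_with_commutant[OF that \<open>T \<in> commutant M\<close>] by simp
      then show ?thesis
        using \<open>h \<in> K\<close> that by (simp add: K_def)
    qed
    then show ?thesis
      by (simp add: K_def)
  qed
  have "P o\<^sub>L x = x o\<^sub>L P" if "x \<in> M" for x
    using that by (intro projection_commutes_if_invariant[OF P(1,3,4)]) (auto intro: K_M)
  then have "P \<in> commutant M"
    using P(1) by (simp add: commutant_def self_adjoint_iff)
  moreover have "P o\<^sub>L T = T o\<^sub>L P" if "T \<in> commutant M" for T
  proof (rule projection_commutes_if_invariant[OF P(1,3,4)])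
    show "T \<in> bounded_operators"
      using that by (simp add: commutant_def)
  qed (use that commutant_adjoint_closed K_commutant in auto)
  then have "P \<in> commutant (commutant M)"
    using P(1) unfolding commutant_def[of "commutant M"] by (simp add: self_adjoint_iff)
  ultimately obtain c where c: "P = scalar_op c"
    using assms(1) unfolding factor_def bicommutant by blast
  from False obtain h where h: "blinfun_apply f h \<noteq> 0"
    by (metis blinfun_eqI zero_blinfun.rep_eq)
  have "blinfun_apply e (blinfun_apply x (blinfun_apply f h)) = 0" if "x \<in> M" for x
    using zero[OF that] by (metis blinfun_apply_blinfun_compose zero_blinfun.rep_eq)
  then have "blinfun_apply f h \<in> K"
    by (simp add: K_def)
  from P(4)[OF this] have "c *\<^sub>C blinfun_apply f h = 1 *\<^sub>C blinfun_apply f h"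
    using scaleC_of_real[of 1 "blinfun_apply f h"] by (simp add: c)
  then have "(c - 1) *\<^sub>C blinfun_apply f h = 0"
    by (metis add_diff_cancel_right' diff_add_cancel diff_self scaleC_add_left)
  then have "cmod (c - 1) * norm (blinfun_apply f h) = 0"
    by (metis norm_scaleC norm_zero)
  with h have "c = 1"
    by simp
  then have "blinfun_apply P k = k" for k
    using scaleC_of_real[of 1 k] by (simp add: c)
  then have "k \<in> K" for k
    by (metis P(3))
  then have "blinfun_apply e k = 0" for k
    using id_closed unfolding K_def by fastforce
  then have "e = 0"
    by (intro blinfun_eqI) simp
  then show ?thesis ..
qed simp

lemma projections_diff:
  assumes "P \<in> projections M" "r \<in> projections M" "P o\<^sub>L r = r"
  shows "P - r \<in> projections M"
proof -
  have "r o\<^sub>L P = r"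
    using assms by (metis adjoint_compose projectionsD(1,2))
  then show ?thesis
    using assms unfolding projections_def self_adjoint_iff
    by (auto simp: compose_diff_left compose_diff_right blinfun.diff_left inner_diff)
qed

end

text \<open>
  Orthonormal vectors have distance \<open>sqrt 2\<close>, so approximations from a dense set within \<open>1/2\<close> are
  distinct.
\<close>

lemma countable_orthonormal_family:
  fixes u :: "'i \<Rightarrow> 'a::real_inner"
  assumes "\<exists>D :: 'a set. countable D \<and> closure D = UNIV"
    and "\<And>x. x \<in> I \<Longrightarrow> norm (u x) = 1"
    and "\<And>x y. x \<in> I \<Longrightarrow> y \<in> I \<Longrightarrow> x \<noteq> y \<Longrightarrow> inner (u x) (u y) = 0"
  shows "countable I"
proof -
  obtain D :: "'a set" where D: "countable D" "closure D = UNIV"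
    using assms(1) by blast
  have "\<exists>d\<in>D. dist d (u x) < 1/2" for x
    using D(2) closure_approachable[of "u x" D] by (metis UNIV_I half_gt_zero zero_less_one)
  then obtain d where d: "\<And>x. d x \<in> D" "\<And>x. dist (d x) (u x) < 1/2"
    by metis
  have "inj_on d I"
  proof (rule inj_onI, rule ccontr)
    fix x y assume xy: "x \<in> I" "y \<in> I" "d x = d y" "x \<noteq> y"
    have "(norm (u x - u y))\<^sup>2 = 2"
      using xy assms(2)[of x] assms(2)[of y] assms(3)[of x y] assms(3)[of y x]
      by (simp add: power2_norm_eq_inner inner_diff norm_eq_1)
    moreover have "dist (u x) (u y) < 1"
      using d(2)[of x] d(2)[of y] dist_triangle_half_l[of "u x" "d x" 1 "u y"] xy(3)
      by (simp add: dist_commute)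
    then have "(norm (u x - u y))\<^sup>2 < 1\<^sup>2"
      by (intro power_strict_mono) (auto simp: dist_norm)
    ultimately show False
      by simp
  qed
  moreover have "d ` I \<subseteq> D"
    using d(1) by blast
  ultimately show ?thesis
    using D(1) countable_image_inj_on countable_subset by blast
qed

subclass (in complex_hilbert_space) banach ..

context traced_von_neumann
begin

text \<open>
  The kernel of \<open>c = c p\<close> contains the range of \<open>1 - p\<close>; the projection \<open>e\<close> is what remains of the
  kernel inside the range of \<open>p\<close>.
\<close>

lemma residual_kernel:
  assumes "c \<in> M" "p \<in> projections M" "c o\<^sub>L p = c" "P \<in> projections M"
    and P: "\<And>h. blinfun_apply P h = h \<longleftrightarrow> blinfun_apply c h = 0"
  defines "e \<equiv> P - (id_blinfun - p)"
  shows "e \<in> projections M" "p o\<^sub>L e = e" "blinfun_apply c (blinfun_apply e h) = 0"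
    "blinfun_apply p h = h \<Longrightarrow> blinfun_apply c h = 0 \<Longrightarrow> blinfun_apply e h = h"
    "tr e = tr P - 1 + tr p"
proof -
  note p = projectionsD[OF assms(2)] and P' = projectionsD[OF assms(4)]
  have cp: "blinfun_apply c (blinfun_apply p h) = blinfun_apply c h" for h
    using assms(3) by (metis blinfun_apply_blinfun_compose)
  have P_ge: "P o\<^sub>L (id_blinfun - p) = id_blinfun - p"
  proof (rule blinfun_eqI)
    fix h
    have "blinfun_apply P (h - blinfun_apply p h) = h - blinfun_apply p h"
      using P[of "h - blinfun_apply p h"] by (simp add: blinfun.diff_right cp)
    then show "blinfun_apply (P o\<^sub>L (id_blinfun - p)) h = blinfun_apply (id_blinfun - p) h"
      by (simp add: blinfun.diff_left)
  qed
  then show "e \<in> projections M"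
    unfolding e_def using assms(2,4) by (intro projections_diff projections_complement)
  have "(id_blinfun - p) o\<^sub>L P = id_blinfun - p"
    using arg_cong[OF P_ge, of adjoint_op] p P' projectionsD[OF projections_complement[OF assms(2)]]
    by (simp add: adjoint_compose)
  then have "P - (p o\<^sub>L P) = id_blinfun - p"
    by (simp add: compose_diff_left)
  then have "e = p o\<^sub>L P"
    by (simp add: e_def algebra_simps)
  then show "p o\<^sub>L e = e"
    using p(3) by (simp flip: blinfun_compose_assoc)
  show "blinfun_apply c (blinfun_apply e h) = 0"
    using P[of "blinfun_apply P h"] P'(4)
    by (simp add: e_def blinfun.diff_left blinfun.diff_right cp)
  show "blinfun_apply e h = h" if "blinfun_apply p h = h" "blinfun_apply c h = 0"
    using that P[of h] by (simp add: e_def blinfun.diff_left)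
  show "tr e = tr P - 1 + tr p"
    unfolding e_def using p(1) P'(1) by (simp add: tr_diff tr_id)
qed

text \<open>
  Comparison of projections, in the weak form of a quasi-affinity: an element of \<open>q M p\<close> that is
  injective on the range of \<open>p\<close> and whose adjoint is injective on the range of \<open>q\<close>. It replaces the
  partial isometry of Murray--von Neumann equivalence. Take a maximal family \<open>Y\<close> in \<open>q M p\<close> of
  elements with mutually orthogonal left and right supports and add its members up with positive
  weights. If \<open>e\<close> and \<open>f\<close> are the parts of \<open>p\<close> and \<open>q\<close> left over by the supports of the sum \<open>c\<close>, then
  \<open>f M e = 0\<close> by maximality, so one of them vanishes in a factor; and they have equal trace.
\<close>

lemma quasi_affinity_exists:
  assumes separable: "\<exists>D :: 'h set. countable D \<and> closure D = UNIV"
    and "factor M" "p \<in> projections M" "q \<in> projections M" "tr p = tr q"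
  shows "\<exists>c\<in>M. q o\<^sub>L c = c \<and> c o\<^sub>L p = c \<and>
    (\<forall>h. blinfun_apply p h = h \<and> blinfun_apply c h = 0 \<longrightarrow> h = 0) \<and>
    (\<forall>h. blinfun_apply q h = h \<and> blinfun_apply (adjoint_op c) h = 0 \<longrightarrow> h = 0)"
proof -
  note p = projectionsD[OF assms(3)] and q = projectionsD[OF assms(4)]
  define C where "C = {y \<in> M. q o\<^sub>L y = y \<and> y o\<^sub>L p = y}"
  define orth where "orth y z \<longleftrightarrow> adjoint_op y o\<^sub>L z = 0 \<and> y o\<^sub>L adjoint_op z = 0" for y z :: "'h operator"
  define F where "F = {Y. Y \<subseteq> C \<and> (\<forall>y\<in>Y. \<forall>z\<in>Y. y \<noteq> z \<longrightarrow> orth y z)}"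
  have "\<Union>\<C> \<in> F" if chain: "subset.chain F \<C>" for \<C>
  proof -
    have "orth y z" if "y \<in> \<Union>\<C>" "z \<in> \<Union>\<C>" "y \<noteq> z" for y z
    proof -
      from that obtain A B where "A \<in> \<C>" "B \<in> \<C>" "y \<in> A" "z \<in> B"
        by blast
      moreover have "A \<subseteq> B \<or> B \<subseteq> A"
        using chain calculation by (metis subset_chain_def)
      ultimately obtain A where "A \<in> \<C>" "y \<in> A" "z \<in> A"
        by blast
      then show ?thesis
        using chain that(3) by (auto simp: subset_chain_def F_def)
    qed
    then show ?thesis
      using chain by (auto simp: F_def subset_chain_def)
  qed
  then obtain Y where "Y \<in> F" and max: "\<And>X. X \<in> F \<Longrightarrow> Y \<subseteq> X \<Longrightarrow> X = Y"
    using subset_Zorn'[of F] by blast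
  then have YC: "Y \<subseteq> C" and Y_orth: "\<And>y z. y \<in> Y \<Longrightarrow> z \<in> Y \<Longrightarrow> y \<noteq> z \<Longrightarrow> orth y z"
    by (auto simp: F_def)
  have YM: "y \<in> M" if "y \<in> Y" for y
    using that YC by (auto simp: C_def)
  have Y_insert: "z \<in> Y" if "z \<in> C" "\<And>y. y \<in> Y \<Longrightarrow> orth y z \<and> orth z y" for z
  proof -
    have "insert z Y \<in> F"
      using that YC Y_orth by (auto simp: F_def)
    then show ?thesis
      using max by blast
  qed
  have "0 \<in> Y"
    by (rule Y_insert) (auto simp: C_def orth_def)
  have orth_apply: "inner (blinfun_apply y h) (blinfun_apply z k) = 0"
    "inner (blinfun_apply (adjoint_op y) h) (blinfun_apply (adjoint_op z) k) = 0"
    if "y \<in> Y" "z \<in> Y" "y \<noteq> z" for y z h k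
  proof -
    have "blinfun_apply (adjoint_op y) (blinfun_apply z k) = 0" "blinfun_apply y (blinfun_apply (adjoint_op z) k) = 0"
      using Y_orth[OF that] unfolding orth_def
      by (metis blinfun_apply_blinfun_compose zero_blinfun.rep_eq)+
    then show "inner (blinfun_apply y h) (blinfun_apply z k) = 0"
      "inner (blinfun_apply (adjoint_op y) h) (blinfun_apply (adjoint_op z) k) = 0"
      using YM[OF that(1)] by (simp_all add: adjoint_right[symmetric] adjoint_left)
  qed
  have "countable (Y - {0})"
  proof -
    have "\<exists>h. blinfun_apply y h \<noteq> 0" if "y \<in> Y - {0}" for y
      using that by (metis DiffD2 blinfun_eqI singletonI zero_blinfun.rep_eq)
    then obtain v where v: "\<And>y. y \<in> Y - {0} \<Longrightarrow> blinfun_apply y (v y) \<noteq> 0"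
      by metis
    show ?thesis
      by (rule countable_orthonormal_family[OF separable, of _ "\<lambda>y. sgn (blinfun_apply y (v y))"])
        (auto simp: v norm_sgn sgn_div_norm orth_apply)
  qed
  then have "countable Y"
    by simp
  define w where "w n = from_nat_into Y n" for n
  have w_range: "range w = Y"
    using \<open>countable Y\<close> \<open>0 \<in> Y\<close> unfolding w_def by (metis empty_iff range_from_nat_into)
  have wY: "w n \<in> Y" for n
    using w_range by blast
  define a where "a n = (1/2) ^ n / (1 + norm (w n))" for n
  have a_pos: "0 < a n" for n
    by (simp add: a_def add_pos_nonneg)
  have "summable (\<lambda>n. a n *\<^sub>R w n)"
  proof (rule summable_comparison_test')
    show "summable (\<lambda>n. (1/2 :: real) ^ n)"
      by (rule summable_geometric) simp
    show "norm (a n *\<^sub>R w n) \<le> (1/2) ^ n" for n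
    proof -
      have "norm (w n) / (1 + norm (w n)) \<le> 1"
        by (simp add: divide_le_eq add_pos_nonneg)
      then have "(1/2) ^ n * (norm (w n) / (1 + norm (w n))) \<le> (1/2 :: real) ^ n * 1"
        by (intro mult_left_mono) auto
      then show ?thesis
        using a_pos[of n] by (simp add: a_def)
    qed
  qed
  then obtain c where c: "(\<lambda>n. a n *\<^sub>R w n) sums c"
    by (auto simp: summable_def)
  have c_apply: "(\<lambda>n. a n *\<^sub>R blinfun_apply (w n) h) sums blinfun_apply c h" for h
    using bounded_linear.sums[OF blinfun.bounded_linear_left c, of h] by (simp add: scaleR_blinfun.rep_eq)
  have "c \<in> M"
  proof (rule strong_limit_closed)
    show "(\<Sum>i<n. a i *\<^sub>R w i) \<in> M" for n
      by (intro sum_closed scaleR_closed YM wY)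
    show "(\<lambda>n. blinfun_apply (\<Sum>i<n. a i *\<^sub>R w i) h) \<longlonglongrightarrow> blinfun_apply c h" for h
      using c by (intro blinfun.tendsto tendsto_const) (simp add: sums_def)
  qed
  have "q o\<^sub>L c = c"
  proof (rule sums_unique2)
    show "(\<lambda>n. q o\<^sub>L (a n *\<^sub>R w n)) sums (q o\<^sub>L c)"
      by (rule bounded_linear.sums[OF bounded_bilinear.bounded_linear_right[OF bounded_bilinear_blinfun_compose] c])
    show "(\<lambda>n. q o\<^sub>L (a n *\<^sub>R w n)) sums c"
      using c wY YC by (auto simp: compose_scaleR_right C_def subset_iff)
  qed
  have "c o\<^sub>L p = c"
  proof (rule sums_unique2)
    show "(\<lambda>n. (a n *\<^sub>R w n) o\<^sub>L p) sums (c o\<^sub>L p)"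
      by (rule bounded_linear.sums[OF bounded_bilinear.bounded_linear_left[OF bounded_bilinear_blinfun_compose] c])
    show "(\<lambda>n. (a n *\<^sub>R w n) o\<^sub>L p) sums c"
      using c wY YC by (auto simp: compose_scaleR_left C_def subset_iff)
  qed
  \<comment> \<open>The supports of \<open>c\<close> dominate those of every member of \<open>Y\<close>.\<close>
  have ker_c: "blinfun_apply y h = 0" if "y \<in> Y" "blinfun_apply c h = 0" for y h
  proof -
    let ?t = "\<lambda>n. inner (blinfun_apply y h) (a n *\<^sub>R blinfun_apply (w n) h)"
    have "?t sums 0"
      using bounded_linear.sums[OF bounded_linear_inner_right c_apply[of h], of "blinfun_apply y h"]
      by (simp add: that(2))
    moreover have "0 \<le> ?t n" for n
      using orth_apply(1)[OF that(1) wY[of n], of h h] a_pos[of n] by (cases "w n = y") auto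
    ultimately have "?t n = 0" for n
      using suminf_eq_zero_iff[of ?t] sums_unique[of ?t 0] sums_summable[of ?t 0] by metis
    moreover from that(1) w_range obtain n where "w n = y"
      by blast
    ultimately show ?thesis
      using a_pos[of n] by (metis inner_eq_zero_iff inner_scaleR_right less_irrefl mult_eq_0_iff)
  qed
  have ker_adj_c: "blinfun_apply (adjoint_op y) h = 0" if "y \<in> Y" "blinfun_apply (adjoint_op c) h = 0" for y h
  proof -
    let ?k = "blinfun_apply (adjoint_op y) h"
    let ?t = "\<lambda>n. inner h (a n *\<^sub>R blinfun_apply (w n) ?k)"
    have t_eq: "?t n = a n * inner (blinfun_apply (adjoint_op (w n)) h) ?k" for n
      using YM[OF wY] by (simp add: adjoint_left)
    have "inner h (blinfun_apply c ?k) = 0"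
      using that(2) \<open>c \<in> M\<close> by (simp add: adjoint_left[symmetric])
    then have "?t sums 0"
      using bounded_linear.sums[OF bounded_linear_inner_right c_apply[of ?k], of h] by simp
    moreover have "0 \<le> ?t n" for n
      using orth_apply(2)[OF wY[of n] that(1), of h h] a_pos[of n] unfolding t_eq by (cases "w n = y") auto
    ultimately have "?t n = 0" for n
      using suminf_eq_zero_iff[of ?t] sums_unique[of ?t 0] sums_summable[of ?t 0] by metis
    moreover from that(1) w_range obtain n where "w n = y"
      by blast
    ultimately show ?thesis
      using a_pos[of n] unfolding t_eq by (metis inner_eq_zero_iff less_irrefl mult_eq_0_iff)
  qed
  obtain P Q where PQ: "P \<in> projections M" "Q \<in> projections M" "tr P = tr Q"
    and P: "\<And>h. blinfun_apply P h = h \<longleftrightarrow> blinfun_apply c h = 0"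
    and Q: "\<And>h. blinfun_apply Q h = h \<longleftrightarrow> blinfun_apply (adjoint_op c) h = 0"
    using kernel_projections_same_trace[OF \<open>c \<in> M\<close>] by blast
  define e where "e = P - (id_blinfun - p)"
  define f where "f = Q - (id_blinfun - q)"
  have "adjoint_op c o\<^sub>L q = adjoint_op c"
    by (rule adjoint_absorb_right[OF assms(4) \<open>c \<in> M\<close> \<open>q o\<^sub>L c = c\<close>])
  note e = residual_kernel[OF \<open>c \<in> M\<close> assms(3) \<open>c o\<^sub>L p = c\<close> PQ(1) P, folded e_def]
  note f = residual_kernel[OF adjoint_closed[OF \<open>c \<in> M\<close>] assms(4) \<open>adjoint_op c o\<^sub>L q = adjoint_op c\<close> PQ(2) Q, folded f_def]
  note eM = projectionsD[OF e(1)] and fM = projectionsD[OF f(1)]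
  \<comment> \<open>Any \<open>f x e\<close> could be added to \<open>Y\<close>, hence lies in \<open>Y\<close>, so its support is orthogonal to \<open>e\<close>.\<close>
  have "f o\<^sub>L x o\<^sub>L e = 0" if "x \<in> M" for x
  proof -
    define z where "z = f o\<^sub>L x o\<^sub>L e"
    have "z \<in> M"
      using that eM fM by (simp add: z_def)
    have "e o\<^sub>L p = e"
      using adjoint_absorb_right[OF assms(3) eM(1) e(2)] by (simp add: eM(2))
    then have "z \<in> C"
      using \<open>z \<in> M\<close> f(2) unfolding C_def z_def by (simp add: blinfun_compose_assoc) (metis blinfun_compose_assoc)
    moreover have "orth y z \<and> orth z y" if "y \<in> Y" for y
    proof -
      have "blinfun_apply y (blinfun_apply e h) = 0" "blinfun_apply (adjoint_op y) (blinfun_apply f h) = 0" for h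
        using ker_c[OF that e(3)] ker_adj_c[OF that f(3)] by auto
      then have ye: "y o\<^sub>L e = 0" and yf: "adjoint_op y o\<^sub>L f = 0"
        by (auto intro: blinfun_eqI)
      have "adjoint_op z = e o\<^sub>L adjoint_op (f o\<^sub>L x)"
        unfolding z_def using \<open>x \<in> M\<close> eM fM by (simp add: adjoint_compose)
      then have "y o\<^sub>L adjoint_op z = 0"
        by (simp add: blinfun_compose_assoc[symmetric] ye)
      moreover have "adjoint_op y o\<^sub>L z = 0"
        by (simp add: z_def blinfun_compose_assoc[symmetric] yf)
      ultimately show ?thesis
        using adjoint_compose_eq_0[of y "adjoint_op z"] adjoint_compose_eq_0[of "adjoint_op y" z]
          \<open>z \<in> M\<close> YM[OF that] by (simp add: orth_def)
    qed
    ultimately have "z \<in> Y"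
      by (rule Y_insert)
    then have "blinfun_apply z (blinfun_apply e h) = 0" for h
      using ker_c e(3) by blast
    then have "z = 0"
      unfolding z_def by (intro blinfun_eqI) (simp add: eM(4))
    then show ?thesis
      by (simp add: z_def)
  qed
  then have "f = 0 \<or> e = 0"
    using factor_prime[OF assms(2) fM(1) eM(1)] by blast
  moreover have "tr e = tr f"
    using e(5) f(5) PQ(3) assms(5) by simp
  ultimately have "e = 0" "f = 0"
    using projection_eq_0[OF e(1)] projection_eq_0[OF f(1)] by auto
  then show ?thesis
    using \<open>c \<in> M\<close> \<open>q o\<^sub>L c = c\<close> \<open>c o\<^sub>L p = c\<close> e(4) f(4) by (intro bexI[of _ c]) auto
qed

end

section \<open>Encoding blocks in one self-adjoint operator\<close>

context von_neumann
begin

text \<open>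
  If \<open>T\<close> commutes with \<open>M\<close>, it commutes with \<open>l z r\<close>, hence \<open>l (T z - z T) r = 0\<close>. Injectivity of
  \<open>l\<close> removes the left factor, and injectivity of the adjoint of \<open>r\<close> removes the right one.
\<close>

lemma cancel_quasi_affinities:
  assumes "p \<in> projections M" "q \<in> projections M" "l \<in> M" "r \<in> M"
    and z: "z \<in> bounded_operators" "p o\<^sub>L z = z" "z o\<^sub>L q = z"
    and l_inj: "\<And>h. blinfun_apply p h = h \<Longrightarrow> blinfun_apply l h = 0 \<Longrightarrow> h = 0"
    and r_inj: "\<And>h. blinfun_apply q h = h \<Longrightarrow> blinfun_apply (adjoint_op r) h = 0 \<Longrightarrow> h = 0"
    and "l o\<^sub>L z o\<^sub>L r \<in> M"
  shows "z \<in> M"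
proof -
  have "T o\<^sub>L z = z o\<^sub>L T" if T: "T \<in> commutant M" for T
  proof -
    have T_comm: "T o\<^sub>L x = x o\<^sub>L T" if "x \<in> M" for x
      using T that by (simp add: commutant_def)
    define D where "D = (T o\<^sub>L z) - (z o\<^sub>L T)"
    have "T o\<^sub>L z \<in> bounded_operators" "z o\<^sub>L T \<in> bounded_operators"
      using T z(1) by (auto simp: commutant_def bounded_operators_compose)
    then have D: "D \<in> bounded_operators"
      unfolding D_def by (rule bounded_operators_diff)
    note p = projectionsD[OF assms(1)] and q = projectionsD[OF assms(2)]
    have "p o\<^sub>L (T o\<^sub>L z) = T o\<^sub>L z"
      using T_comm[OF p(1)] z(2) by (metis blinfun_compose_assoc)
    then have pD: "p o\<^sub>L D = D"
      by (simp add: D_def compose_diff_right z(2) flip: blinfun_compose_assoc)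
    have "(z o\<^sub>L T) o\<^sub>L q = z o\<^sub>L T"
      using T_comm[OF q(1)] z(3) by (metis blinfun_compose_assoc)
    then have Dq: "D o\<^sub>L q = D"
      by (simp add: D_def compose_diff_left z(3) blinfun_compose_assoc)
    have "l o\<^sub>L (T o\<^sub>L z) o\<^sub>L r = T o\<^sub>L (l o\<^sub>L z o\<^sub>L r)"
      using T_comm[OF assms(3)] by (metis blinfun_compose_assoc)
    moreover have "l o\<^sub>L (z o\<^sub>L T) o\<^sub>L r = (l o\<^sub>L z o\<^sub>L r) o\<^sub>L T"
      using T_comm[OF assms(4)] by (metis blinfun_compose_assoc)
    ultimately have "l o\<^sub>L D o\<^sub>L r = 0"
      using T_comm[OF assms(10)] by (simp add: D_def compose_diff_left compose_diff_right)
    then have "blinfun_apply l (blinfun_apply D (blinfun_apply r h)) = 0" for h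
      by (metis blinfun_apply_blinfun_compose zero_blinfun.rep_eq)
    moreover have "blinfun_apply p (blinfun_apply D h) = blinfun_apply D h" for h
      using pD by (metis blinfun_apply_blinfun_compose)
    ultimately have Dr: "blinfun_apply D (blinfun_apply r h) = 0" for h
      using l_inj by blast
    have "blinfun_apply (adjoint_op r) (blinfun_apply (adjoint_op D) h) = 0" for h
    proof (rule eq_if_inner_eq)
      fix k
      show "inner (blinfun_apply (adjoint_op r) (blinfun_apply (adjoint_op D) h)) k = inner 0 k"
        using assms(4) D Dr by (simp add: adjoint_left adjoint_op_left)
    qed
    moreover have "q o\<^sub>L adjoint_op D = adjoint_op D"
      using arg_cong[OF Dq, of adjoint_op] D q by (simp add: adjoint_op_compose)
    then have "blinfun_apply q (blinfun_apply (adjoint_op D) h) = blinfun_apply (adjoint_op D) h" for h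
      by (metis blinfun_apply_blinfun_compose)
    ultimately have "blinfun_apply (adjoint_op D) h = 0" for h
      using r_inj by blast
    then have "adjoint_op D = 0"
      by (intro blinfun_eqI) simp
    then have "D = 0"
      using adjoint_op_adjoint_op[OF D] by simp
    then show ?thesis
      by (simp add: D_def)
  qed
  then have "z \<in> commutant (commutant M)"
    using z(1) unfolding commutant_def[of "commutant M"] by auto
  then show ?thesis
    by (simp add: bicommutant)
qed

end

locale partition_of_unity = von_neumann M for M :: "'h::complex_hilbert_space operator set" +
  fixes k :: nat and p :: "nat \<Rightarrow> 'h operator"
  assumes p_proj: "j \<in> {1..k} \<Longrightarrow> p j \<in> projections M"
    and p_orth: "i \<in> {1..k} \<Longrightarrow> j \<in> {1..k} \<Longrightarrow> i \<noteq> j \<Longrightarrow> p i o\<^sub>L p j = 0"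
    and p_sum: "(\<Sum>j\<in>{1..k}. p j) = id_blinfun"
begin

lemma p_closed: "j \<in> {1..k} \<Longrightarrow> p j \<in> M"
  and p_adjoint: "j \<in> {1..k} \<Longrightarrow> adjoint_op (p j) = p j"
  and p_idem: "j \<in> {1..k} \<Longrightarrow> p j o\<^sub>L p j = p j"
  using projectionsD[OF p_proj] by auto

lemma block_decomposition: "(\<Sum>i\<in>{1..k}. \<Sum>j\<in>{1..k}. p i o\<^sub>L x o\<^sub>L p j) = x"
proof -
  have "(\<Sum>i\<in>{1..k}. p i) o\<^sub>L x o\<^sub>L (\<Sum>j\<in>{1..k}. p j) = (\<Sum>i\<in>{1..k}. \<Sum>j\<in>{1..k}. p i o\<^sub>L x o\<^sub>L p j)"
    unfolding compose_sum_left unfolding compose_sum_right ..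
  then show ?thesis
    unfolding p_sum by simp
qed

text \<open>
  The diagonal operator with the distinct entries \<open>1, \<dots>, k\<close> generates the partition: an operator
  commuting with it has no off-diagonal blocks.
\<close>

lemma partition_from_diagonal:
  assumes N: "von_neumann_algebra N" and a: "(\<Sum>j\<in>{1..k}. real j *\<^sub>R p j) \<in> N" and j: "j \<in> {1..k}"
  shows "p j \<in> N"
proof -
  interpret N: von_neumann N
    by unfold_locales (rule N)
  define a where "a = (\<Sum>j\<in>{1..k}. real j *\<^sub>R p j)"
  have pa: "p i o\<^sub>L a = real i *\<^sub>R p i" if "i \<in> {1..k}" for i
  proof -
    have "p i o\<^sub>L a = (\<Sum>j\<in>{1..k}. if j = i then real i *\<^sub>R p i else 0)"
      unfolding a_def compose_sum_right compose_scaleR_right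
      using that by (intro sum.cong) (auto simp: p_orth p_idem)
    then show ?thesis
      using that by simp
  qed
  have ap: "a o\<^sub>L p i = real i *\<^sub>R p i" if "i \<in> {1..k}" for i
  proof -
    have "a o\<^sub>L p i = (\<Sum>j\<in>{1..k}. if j = i then real i *\<^sub>R p i else 0)"
      unfolding a_def compose_sum_left compose_scaleR_left
      using that by (intro sum.cong) (auto simp: p_orth p_idem)
    then show ?thesis
      using that by simp
  qed
  have "T o\<^sub>L p j = p j o\<^sub>L T" if T: "T \<in> commutant N" for T
  proof -
    have Ta: "T o\<^sub>L a = a o\<^sub>L T"
      using T a unfolding a_def commutant_def by blast
    have off_diagonal: "p i o\<^sub>L T o\<^sub>L p l = 0" if "i \<in> {1..k}" "l \<in> {1..k}" "i \<noteq> l" for i l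
    proof -
      have "p i o\<^sub>L (T o\<^sub>L a) o\<^sub>L p l = real l *\<^sub>R (p i o\<^sub>L T o\<^sub>L p l)"
        by (simp add: blinfun_compose_assoc ap[OF that(2)] compose_scaleR_right)
      moreover have "p i o\<^sub>L (a o\<^sub>L T) o\<^sub>L p l = real i *\<^sub>R (p i o\<^sub>L T o\<^sub>L p l)"
        by (simp add: pa[OF that(1)] compose_scaleR_left flip: blinfun_compose_assoc)
      ultimately have "real l *\<^sub>R (p i o\<^sub>L T o\<^sub>L p l) = real i *\<^sub>R (p i o\<^sub>L T o\<^sub>L p l)"
        by (simp only: Ta)
      then show ?thesis
        using that(3) by (simp only: scaleR_cancel_right of_nat_eq_iff) auto
    qed
    have "T o\<^sub>L p j = (\<Sum>i\<in>{1..k}. p i) o\<^sub>L T o\<^sub>L p j"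
      unfolding p_sum by simp
    also have "\<dots> = (\<Sum>i\<in>{1..k}. if i = j then p j o\<^sub>L T o\<^sub>L p j else 0)"
      unfolding compose_sum_left using j by (intro sum.cong) (auto simp: off_diagonal)
    also have "\<dots> = (\<Sum>i\<in>{1..k}. p j o\<^sub>L T o\<^sub>L p i)"
      using j by (intro sum.cong) (auto simp: off_diagonal)
    also have "\<dots> = p j o\<^sub>L T"
      unfolding compose_sum_right[symmetric] p_sum by simp
    finally show ?thesis .
  qed
  moreover have "p j \<in> bounded_operators"
    using j p_closed by simp
  ultimately have "p j \<in> commutant (commutant N)"
    unfolding commutant_def[of "commutant N"] by auto
  then show ?thesis
    by (simp add: N.bicommutant)
qed

text \<open>
  The adjoints that make the sum self-adjoint occupy positions below the diagonal, so they do not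
  disturb the blocks above it.
\<close>

lemma corner_of_upper_triangular:
  assumes u: "\<And>s t. 1 \<le> s \<Longrightarrow> s < t \<Longrightarrow> t \<le> k \<Longrightarrow> u s t \<in> M \<and> p s o\<^sub>L u s t = u s t \<and> u s t o\<^sub>L p t = u s t"
    and st: "1 \<le> s" "s < t" "t \<le> k"
  shows "p s o\<^sub>L (\<Sum>(x, y)\<in>{(x, y). 1 \<le> x \<and> x < y \<and> y \<le> k}. u x y + adjoint_op (u x y)) o\<^sub>L p t = u s t"
proof -
  define U where "U = {(x, y). 1 \<le> x \<and> x < y \<and> y \<le> k}"
  have "finite U"
    by (rule finite_subset[of _ "{1..k} \<times> {1..k}"]) (auto simp: U_def)
  have summand: "p s o\<^sub>L (u x y + adjoint_op (u x y)) o\<^sub>L p t = (if (x, y) = (s, t) then u s t else 0)"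
    if "(x, y) \<in> U" for x y
  proof -
    have xy: "1 \<le> x" "x < y" "y \<le> k"
      using that by (auto simp: U_def)
    have mem: "x \<in> {1..k}" "y \<in> {1..k}" "s \<in> {1..k}" "t \<in> {1..k}"
      using xy st by auto
    have uM: "u x y \<in> M" and pu: "p x o\<^sub>L u x y = u x y" and up: "u x y o\<^sub>L p y = u x y"
      using u[OF xy] by auto
    have 1: "p s o\<^sub>L u x y o\<^sub>L p t = (if (x, y) = (s, t) then u s t else 0)"
    proof (cases "x = s \<and> y = t")
      case True
      then show ?thesis
        using pu up by simp
    next
      case False
      have "p s o\<^sub>L u x y o\<^sub>L p t = (p s o\<^sub>L p x) o\<^sub>L u x y o\<^sub>L (p y o\<^sub>L p t)"
        using pu up by (metis blinfun_compose_assoc)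
      moreover have "p s o\<^sub>L p x = 0 \<or> p y o\<^sub>L p t = 0"
        using False p_orth[OF mem(3,1)] p_orth[OF mem(2,4)] by blast
      ultimately show ?thesis
        using False by auto
    qed
    have "p s o\<^sub>L adjoint_op (u x y) o\<^sub>L p t = (p s o\<^sub>L p y) o\<^sub>L adjoint_op (u x y) o\<^sub>L (p x o\<^sub>L p t)"
      using adjoint_absorb_left[OF p_proj[OF mem(2)] uM up] adjoint_absorb_right[OF p_proj[OF mem(1)] uM pu]
      by (metis blinfun_compose_assoc)
    also have "\<dots> = 0"
    proof -
      \<comment> \<open>Otherwise \<open>s = y\<close> and \<open>x = t\<close>, which contradicts \<open>s < t\<close> and \<open>x < y\<close>.\<close>
      have "p s o\<^sub>L p y = 0 \<or> p x o\<^sub>L p t = 0"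
        using p_orth[OF mem(3,2)] p_orth[OF mem(1,4)] xy(2) st(2) by fastforce
      then show ?thesis
        by auto
    qed
    finally show ?thesis
      by (simp add: 1 compose_add_left compose_add_right)
  qed
  have "p s o\<^sub>L (\<Sum>(x, y)\<in>U. u x y + adjoint_op (u x y)) o\<^sub>L p t =
      (\<Sum>(x, y)\<in>U. if (x, y) = (s, t) then u s t else 0)"
    unfolding compose_sum_left compose_sum_right by (intro sum.cong) (auto simp: summand)
  also have "\<dots> = (\<Sum>xy\<in>U. if xy = (s, t) then u s t else 0)"
    by (simp add: case_prod_unfold prod_eq_iff)
  also have "\<dots> = u s t"
    using \<open>finite U\<close> st by (simp add: U_def)
  finally show ?thesis
    by (simp add: U_def)
qed

text \<open>
  The first row of \<open>b\<close> stores the quasi-affinities \<open>c j\<close> for \<open>j \<ge> 2\<close>, and position \<open>\<phi> \<beta>\<close>, below that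
  row, stores the block \<open>z \<beta>\<close>. The first row serves to carry a block from any position to any other
  via \<open>p 1\<close>: the factor \<open>L \<beta>\<close> below changes its row from \<open>tgt \<beta>\<close> to that of \<open>\<phi> \<beta>\<close>, and \<open>R \<beta>\<close> changes its
  column from \<open>src \<beta>\<close> likewise.
\<close>

lemma blocks_from_two_self_adjoints:
  fixes z :: "'b \<Rightarrow> 'h operator"
  assumes "1 \<le> k" "c 1 = p 1"
    and c: "\<And>j. j \<in> {1..k} \<Longrightarrow> c j \<in> M \<and> p 1 o\<^sub>L c j = c j \<and> c j o\<^sub>L p j = c j"
    and c_inj: "\<And>j h. j \<in> {1..k} \<Longrightarrow> blinfun_apply (p j) h = h \<Longrightarrow> blinfun_apply (c j) h = 0 \<Longrightarrow> h = 0"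
    and c_adj_inj: "\<And>j h. j \<in> {1..k} \<Longrightarrow> blinfun_apply (p 1) h = h \<Longrightarrow>
      blinfun_apply (adjoint_op (c j)) h = 0 \<Longrightarrow> h = 0"
    and z: "\<And>\<beta>. \<beta> \<in> B \<Longrightarrow> tgt \<beta> \<in> {1..k} \<and> src \<beta> \<in> {1..k} \<and> z \<beta> \<in> M \<and>
      p (tgt \<beta>) o\<^sub>L z \<beta> = z \<beta> \<and> z \<beta> o\<^sub>L p (src \<beta>) = z \<beta>"
    and \<phi>: "inj_on \<phi> B" "\<phi> ` B \<subseteq> {(s, t). 2 \<le> s \<and> s < t \<and> t \<le> k}"
  shows "\<exists>a\<in>M. \<exists>b\<in>M. self_adjoint a \<and> self_adjoint b \<and>
    (\<forall>N. von_neumann_algebra N \<and> a \<in> N \<and> b \<in> N \<longrightarrow> z ` B \<subseteq> N)"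
proof -
  define L where "L \<beta> = adjoint_op (c (fst (\<phi> \<beta>))) o\<^sub>L c (tgt \<beta>)" for \<beta>
  define R where "R \<beta> = adjoint_op (c (src \<beta>)) o\<^sub>L c (snd (\<phi> \<beta>))" for \<beta>
  define u where "u s t = (if s = 1 then c t else if (s, t) \<in> \<phi> ` B
    then L (inv_into B \<phi> (s, t)) o\<^sub>L z (inv_into B \<phi> (s, t)) o\<^sub>L R (inv_into B \<phi> (s, t)) else 0)" for s t
  define a where "a = (\<Sum>j\<in>{1..k}. real j *\<^sub>R p j)"
  define U where "U = {(x, y). 1 \<le> x \<and> x < y \<and> y \<le> k}"
  define b where "b = (\<Sum>(x, y)\<in>U. u x y + adjoint_op (u x y))"
  have \<phi>_range: "fst (\<phi> \<beta>) \<in> {2..k}" "snd (\<phi> \<beta>) \<in> {2..k}" "fst (\<phi> \<beta>) < snd (\<phi> \<beta>)" if "\<beta> \<in> B" for \<beta>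
  proof -
    have "\<phi> \<beta> \<in> {(s, t). 2 \<le> s \<and> s < t \<and> t \<le> k}"
      using subsetD[OF \<phi>(2) imageI[OF that]] .
    then show "fst (\<phi> \<beta>) \<in> {2..k}" "snd (\<phi> \<beta>) \<in> {2..k}" "fst (\<phi> \<beta>) < snd (\<phi> \<beta>)"
      by (auto simp: case_prod_unfold)
  qed
  have adj_c: "p j o\<^sub>L adjoint_op (c j) = adjoint_op (c j)" if "j \<in> {1..k}" for j
    using adjoint_absorb_left[OF p_proj[OF that]] c[OF that] by blast
  have LR: "L \<beta> \<in> M" "R \<beta> \<in> M" "p (fst (\<phi> \<beta>)) o\<^sub>L L \<beta> = L \<beta>" "R \<beta> o\<^sub>L p (snd (\<phi> \<beta>)) = R \<beta>"
    if "\<beta> \<in> B" for \<beta>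
  proof -
    have mem: "fst (\<phi> \<beta>) \<in> {1..k}" "snd (\<phi> \<beta>) \<in> {1..k}" "tgt \<beta> \<in> {1..k}" "src \<beta> \<in> {1..k}"
      using \<phi>_range[OF that] z[OF that] by auto
    show "L \<beta> \<in> M" "R \<beta> \<in> M"
      using c[OF mem(1)] c[OF mem(2)] c[OF mem(3)] c[OF mem(4)] by (simp_all add: L_def R_def)
    show "p (fst (\<phi> \<beta>)) o\<^sub>L L \<beta> = L \<beta>"
      unfolding L_def blinfun_compose_assoc[symmetric] adj_c[OF mem(1)] ..
    show "R \<beta> o\<^sub>L p (snd (\<phi> \<beta>)) = R \<beta>"
      using c[OF mem(2)] unfolding R_def blinfun_compose_assoc by simp
  qed
  have u: "u s t \<in> M \<and> p s o\<^sub>L u s t = u s t \<and> u s t o\<^sub>L p t = u s t"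
    if "1 \<le> s" "s < t" "t \<le> k" for s t
  proof (cases "s \<noteq> 1 \<and> (s, t) \<in> \<phi> ` B")
    case True
    define \<beta> where "\<beta> = inv_into B \<phi> (s, t)"
    have \<beta>: "\<beta> \<in> B" "\<phi> \<beta> = (s, t)"
      using True unfolding \<beta>_def by (auto intro: inv_into_into f_inv_into_f)
    have "u s t = L \<beta> o\<^sub>L z \<beta> o\<^sub>L R \<beta>"
      using True by (simp add: u_def \<beta>_def)
    then show ?thesis
      using LR[OF \<beta>(1)] z[OF \<beta>(1)] \<beta>(2) by (simp add: blinfun_compose_assoc) (metis blinfun_compose_assoc)
  next
    case False
    then show ?thesis
      using that c[of t] by (auto simp: u_def)
  qed
  have "a \<in> M"
    unfolding a_def by (intro sum_closed scaleR_closed p_closed)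
  moreover have "b \<in> M"
    unfolding b_def using u by (intro sum_closed) (auto simp: U_def)
  moreover have "adjoint_op a = a"
    unfolding a_def by (subst adjoint_sum) (auto intro!: sum.cong simp: p_closed adjoint_scaleR p_adjoint)
  moreover have "adjoint_op b = b"
    unfolding b_def using u
    by (subst adjoint_sum) (auto intro!: sum.cong simp: U_def adjoint_add add.commute)
  moreover have "z \<beta> \<in> N" if N: "von_neumann_algebra N" and "a \<in> N" "b \<in> N" and "\<beta> \<in> B" for N \<beta>
  proof -
    interpret N: von_neumann N
      by unfold_locales (rule N)
    have pN: "p j \<in> N" if "j \<in> {1..k}" for j
      using partition_from_diagonal[OF N _ that] \<open>a \<in> N\<close> by (simp add: a_def)
    have uN: "u s t \<in> N" if "1 \<le> s" "s < t" "t \<le> k" for s t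
    proof -
      have "u s t = p s o\<^sub>L b o\<^sub>L p t"
        unfolding b_def U_def using corner_of_upper_triangular[of u, OF u that] by simp
      then show ?thesis
        using pN[of s] pN[of t] that \<open>b \<in> N\<close> by simp
    qed
    have cN: "c j \<in> N" if "j \<in> {1..k}" for j
      using uN[of 1 j] pN[of 1] that assms(1,2) by (cases "j = 1") (auto simp: u_def)
    have mem: "fst (\<phi> \<beta>) \<in> {1..k}" "snd (\<phi> \<beta>) \<in> {1..k}" "tgt \<beta> \<in> {1..k}" "src \<beta> \<in> {1..k}"
      using \<phi>_range[OF \<open>\<beta> \<in> B\<close>] z[OF \<open>\<beta> \<in> B\<close>] by auto
    have proj_N: "p j \<in> projections N" if "j \<in> {1..k}" for j
      using pN[OF that] p_adjoint[OF that] p_idem[OF that] by (rule N.projectionsI)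
    show ?thesis
    proof (rule N.cancel_quasi_affinities[of "p (tgt \<beta>)" "p (src \<beta>)" "L \<beta>" "R \<beta>"])
      show "p (tgt \<beta>) \<in> projections N" "p (src \<beta>) \<in> projections N"
        using mem proj_N by auto
      show "L \<beta> \<in> N" "R \<beta> \<in> N"
        unfolding L_def R_def by (intro N.compose_closed N.adjoint_closed cN mem)+
      show "z \<beta> \<in> bounded_operators" "p (tgt \<beta>) o\<^sub>L z \<beta> = z \<beta>" "z \<beta> o\<^sub>L p (src \<beta>) = z \<beta>"
        using z[OF \<open>\<beta> \<in> B\<close>] by auto
      have range_c: "blinfun_apply (p 1) (blinfun_apply (c j) h) = blinfun_apply (c j) h" if "j \<in> {1..k}" for j h
        using c[OF that] by (metis blinfun_apply_blinfun_compose)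
      show "h = 0" if "blinfun_apply (p (tgt \<beta>)) h = h" "blinfun_apply (L \<beta>) h = 0" for h
      proof (rule c_inj[OF mem(3) that(1)])
        show "blinfun_apply (c (tgt \<beta>)) h = 0"
          using that(2) by (intro c_adj_inj[OF mem(1) range_c[OF mem(3)]]) (simp add: L_def)
      qed
      have adj_R: "adjoint_op (R \<beta>) = adjoint_op (c (snd (\<phi> \<beta>))) o\<^sub>L c (src \<beta>)"
        using c[OF mem(2)] c[OF mem(4)] by (simp add: R_def adjoint_compose)
      show "h = 0" if "blinfun_apply (p (src \<beta>)) h = h" "blinfun_apply (adjoint_op (R \<beta>)) h = 0" for h
      proof (rule c_inj[OF mem(4) that(1)])
        show "blinfun_apply (c (src \<beta>)) h = 0"
          using that(2) by (intro c_adj_inj[OF mem(2) range_c[OF mem(4)]]) (simp add: adj_R)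
      qed
      have "u (fst (\<phi> \<beta>)) (snd (\<phi> \<beta>)) = L \<beta> o\<^sub>L z \<beta> o\<^sub>L R \<beta>"
        using \<phi>_range[OF \<open>\<beta> \<in> B\<close>] \<open>\<beta> \<in> B\<close> \<phi>(1) by (simp add: u_def)
      then show "L \<beta> o\<^sub>L z \<beta> o\<^sub>L R \<beta> \<in> N"
        using uN[of "fst (\<phi> \<beta>)" "snd (\<phi> \<beta>)"] \<phi>_range[OF \<open>\<beta> \<in> B\<close>] by simp
    qed
  qed
  ultimately show ?thesis
    by (intro bexI[of _ a] bexI[of _ b]) (auto simp: self_adjoint_def)
qed

end

context traced_von_neumann
begin

lemma equal_family_tr:
  assumes "p \<in> equal_families M \<tau> k" "j \<in> {1..k}"
  shows "tr (p j) = 1 / real k"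
proof -
  have "\<tau> (p j) = 1 / of_nat k"
    using assms unfolding equal_families_def by blast
  then show ?thesis
    by (simp add: Re_divide_of_nat)
qed

text \<open>The complement of the sum of the family is a projection of trace 0, so it vanishes.\<close>

lemma equal_family_partition:
  assumes "p \<in> equal_families M \<tau> k" "1 \<le> k"
  shows "partition_of_unity M k p"
proof -
  note p_tr = equal_family_tr[OF assms(1)]
  have p_proj: "p j \<in> projections M" if "j \<in> {1..k}" for j
    using assms(1) that unfolding equal_families_def by blast
  have p_orth: "p i o\<^sub>L p j = 0" if "i \<in> {1..k}" "j \<in> {1..k}" "i \<noteq> j" for i j
    using assms(1) that unfolding equal_families_def by blast
  have "(\<Sum>j\<in>{1..k}. p j) = id_blinfun"
  proof -
    let ?s = "\<Sum>j\<in>{1..k}. p j"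
    have pM: "p j \<in> M" if "j \<in> {1..k}" for j
      using p_proj[OF that] projectionsD(1) by blast
    have "?s \<in> M"
      by (rule sum_closed) (rule pM)
    moreover have "adjoint_op ?s = ?s"
    proof -
      have "adjoint_op ?s = (\<Sum>j\<in>{1..k}. adjoint_op (p j))"
        by (rule adjoint_sum) (rule pM)
      also have "\<dots> = ?s"
        by (rule sum.cong[OF refl]) (rule projectionsD(2)[OF p_proj])
      finally show ?thesis .
    qed
    moreover have "?s o\<^sub>L ?s = ?s"
    proof -
      have "p i o\<^sub>L ?s = p i" if "i \<in> {1..k}" for i
      proof -
        have "p i o\<^sub>L ?s = (\<Sum>j\<in>{1..k}. if j = i then p i else 0)"
          unfolding compose_sum_right using that p_orth p_proj
          by (intro sum.cong) (auto simp: projectionsD(3))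
        then show ?thesis
          using that by simp
      qed
      then show ?thesis
        by (simp only: compose_sum_left) (intro sum.cong, auto)
    qed
    ultimately have "?s \<in> projections M"
      by (rule projectionsI)
    moreover have "tr (id_blinfun - ?s) = 0"
    proof -
      have "tr ?s = (\<Sum>j\<in>{1..k}. tr (p j))"
        by (rule tr_sum) (rule pM)
      also have "\<dots> = (\<Sum>j\<in>{1..k}. 1 / real k)"
        by (rule sum.cong[OF refl]) (rule p_tr)
      also have "\<dots> = 1"
        using assms(2) by simp
      finally show ?thesis
        using \<open>?s \<in> M\<close> by (simp add: tr_diff tr_id)
    qed
    ultimately have "id_blinfun - ?s = 0"
      using projection_eq_0 projections_complement by blast
    then show ?thesis
      by simp
  qed
  with p_proj p_orth show ?thesis
    by unfold_locales
qed

end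

section \<open>Counting blocks\<close>

lemma card_upper_triangle:
  "2 * card {(s, t). 2 \<le> s \<and> s < t \<and> t \<le> k} = (k - 1) * (k - 2)" for k :: nat
proof -
  have "{(s, t). 2 \<le> s \<and> s < t \<and> t \<le> k} = prod.swap ` (SIGMA t:{..k}. {2..<t})"
    by (auto simp: image_iff)
  then have "card {(s, t). 2 \<le> s \<and> s < t \<and> t \<le> k} = (\<Sum>t\<le>k. t - 2)"
    by (simp add: card_image inj_on_def)
  moreover have "2 * (\<Sum>t\<le>k. t - 2) = (k - 1) * (k - 2)"
  proof (induction k)
    case (Suc k)
    show ?case
    proof (cases "k < 2")
      case False
      then obtain n where "k = n + 2"
        by (metis add.commute le_Suc_ex not_less)
      with Suc show ?thesis
        by (simp add: algebra_simps)
    qed (auto simp: less_2_cases_iff)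
  qed simp
  ultimately show ?thesis
    by simp
qed

text \<open>
  For \<open>k \<ge> 6\<close> the strict upper triangle without its first row has
  \<open>(k - 1) * (k - 2) / 2 \<ge> k\<^sup>2 / 4\<close> positions.
\<close>

lemma quarter_fits_upper_triangle:
  assumes "6 \<le> k" "4 * n < k\<^sup>2"
  shows "n \<le> card {(s, t). 2 \<le> s \<and> s < t \<and> t \<le> (k::nat)}"
proof -
  obtain m where m: "k = m + 6"
    using assms(1) by (metis add.commute le_Suc_ex)
  have "k\<^sup>2 \<le> 2 * ((k - 1) * (k - 2))"
    by (simp add: m power2_eq_square algebra_simps)
  then show ?thesis
    using assms(2) card_upper_triangle[of k] by linarith
qed

lemma family_density_eq_card:
  fixes p :: "nat \<Rightarrow> 'h::complex_hilbert_space operator"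
  shows "family_density k p xs = real (card {(m, i, j). m < length xs \<and> i \<in> {1..k} \<and> j \<in> {1..k} \<and>
    p i o\<^sub>L xs ! m o\<^sub>L p j \<noteq> 0}) / (real k)\<^sup>2"
proof -
  let ?A = "\<lambda>x. {(i, j). i \<in> {1..k} \<and> j \<in> {1..k} \<and> p i o\<^sub>L x o\<^sub>L p j \<noteq> 0}"
  have fin: "finite (?A x)" for x
    by (rule finite_subset[of _ "{1..k} \<times> {1..k}"]) auto
  have "{(m, i, j). m < length xs \<and> i \<in> {1..k} \<and> j \<in> {1..k} \<and> p i o\<^sub>L xs ! m o\<^sub>L p j \<noteq> 0} =
      (SIGMA m:{..<length xs}. ?A (xs ! m))"
    by auto
  moreover have "card (SIGMA m:{..<length xs}. ?A (xs ! m)) = (\<Sum>m<length xs. card (?A (xs ! m)))"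
    by (rule card_SigmaI) (use fin in auto)
  moreover have "family_density k p xs = (\<Sum>m<length xs. cell_density k p (xs ! m))"
    unfolding family_density_def by (simp add: sum_list_sum_nth atLeast0LessThan)
  ultimately show ?thesis
    by (simp add: cell_density_def sum_divide_distrib)
qed

theorem theorem4p2:
  fixes M :: "'h::complex_hilbert_space operator set"
    and \<tau> :: "'h operator \<Rightarrow> complex"
  assumes separable: "\<exists>D :: 'h set. countable D \<and> closure D = UNIV"
    and II1: "type_II1_factor M"
    and trace: "faithful_normal_tracial_state M \<tau>"
    and small: "G_invariant M \<tau> < ereal (1 / 4)"
  shows "singly_generated M"
proof -
  have factor: "factor M"
    using II1 by (simp add: type_II1_factor_def)
  interpret traced_von_neumann M \<tau>
    by unfold_locales (use factor trace in \<open>auto simp: factor_def\<close>)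
  have "\<exists>k\<ge>6. G_level M \<tau> k < ereal (1 / 4)"
  proof (rule ccontr)
    assume "\<not> ?thesis"
    then have "\<forall>\<^sub>F k in sequentially. ereal (1 / 4) \<le> G_level M \<tau> k"
      by (auto simp: eventually_sequentially not_less)
    from Liminf_bounded[OF this] small show False
      by (simp add: G_invariant_def)
  qed
  then obtain k where k: "6 \<le> k" "G_level M \<tau> k < ereal (1 / 4)"
    by blast
  then obtain xs where xs: "xs \<in> generating_families M" "min_density M \<tau> k xs < ereal (1 / 4)"
    unfolding G_level_def INF_less_iff by blast
  then obtain p where p: "p \<in> equal_families M \<tau> k" "family_density k p xs < 1 / 4"
    unfolding min_density_def INF_less_iff by auto
  interpret partition_of_unity M k p
    using p(1) k(1) by (intro equal_family_partition) auto
  have p_tr: "tr (p j) = 1 / real k" if "j \<in> {1..k}" for j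
    using equal_family_tr[OF p(1) that] .
  have one: "1 \<in> {1..k}"
    using k(1) by simp
  have "\<exists>c\<in>M. p 1 o\<^sub>L c = c \<and> c o\<^sub>L p j = c \<and>
      (\<forall>h. blinfun_apply (p j) h = h \<and> blinfun_apply c h = 0 \<longrightarrow> h = 0) \<and>
      (\<forall>h. blinfun_apply (p 1) h = h \<and> blinfun_apply (adjoint_op c) h = 0 \<longrightarrow> h = 0)" if "j \<in> {1..k}" for j
    using quasi_affinity_exists[OF separable factor p_proj[OF that] p_proj[OF one]] p_tr that one by simp
  then obtain c' where c': "\<And>j. j \<in> {1..k} \<Longrightarrow> c' j \<in> M \<and> p 1 o\<^sub>L c' j = c' j \<and> c' j o\<^sub>L p j = c' j \<and>
      (\<forall>h. blinfun_apply (p j) h = h \<and> blinfun_apply (c' j) h = 0 \<longrightarrow> h = 0) \<and>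
      (\<forall>h. blinfun_apply (p 1) h = h \<and> blinfun_apply (adjoint_op (c' j)) h = 0 \<longrightarrow> h = 0)"
    by metis
  \<comment> \<open>Position \<open>(1, 1)\<close> is not available in the upper triangle; the projection \<open>p 1\<close> is a quasi-affinity
    from \<open>p 1\<close> to itself that the diagonal operator already provides.\<close>
  define c where "c = c'(1 := p 1)"
  have c_all: "c j \<in> M \<and> p 1 o\<^sub>L c j = c j \<and> c j o\<^sub>L p j = c j \<and>
      (\<forall>h. blinfun_apply (p j) h = h \<and> blinfun_apply (c j) h = 0 \<longrightarrow> h = 0) \<and>
      (\<forall>h. blinfun_apply (p 1) h = h \<and> blinfun_apply (adjoint_op (c j)) h = 0 \<longrightarrow> h = 0)"
    if "j \<in> {1..k}" for j
  proof (cases "j = 1")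
    case True
    then have "c j = p 1"
      by (simp add: c_def)
    then show ?thesis
      using p_closed[OF one] p_idem[OF one] p_adjoint[OF one] True by metis
  next
    case False
    then have "c j = c' j"
      by (simp add: c_def)
    show ?thesis
      unfolding \<open>c j = c' j\<close> by (rule c'[OF that])
  qed
  have c: "c j \<in> M \<and> p 1 o\<^sub>L c j = c j \<and> c j o\<^sub>L p j = c j"
    "blinfun_apply (p j) h = h \<Longrightarrow> blinfun_apply (c j) h = 0 \<Longrightarrow> h = 0"
    "blinfun_apply (p 1) h = h \<Longrightarrow> blinfun_apply (adjoint_op (c j)) h = 0 \<Longrightarrow> h = 0"
    if "j \<in> {1..k}" for j h
    using c_all[OF that] by blast+
  define B where "B = {(m, i, j). m < length xs \<and> i \<in> {1..k} \<and> j \<in> {1..k} \<and> p i o\<^sub>L xs ! m o\<^sub>L p j \<noteq> 0}"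
  define z where "z = (\<lambda>(m, i, j). p i o\<^sub>L xs ! m o\<^sub>L p j)"
  have "finite B"
    by (rule finite_subset[of _ "{..<length xs} \<times> {1..k} \<times> {1..k}"]) (auto simp: B_def)
  have "real (card B) / (real k)\<^sup>2 < 1 / 4"
    using p(2) by (simp add: family_density_eq_card B_def)
  then have "real (4 * card B) < real (k\<^sup>2)"
    using k(1) by (simp add: field_simps)
  then have "card B \<le> card {(s, t). 2 \<le> s \<and> s < t \<and> t \<le> k}"
    using k(1) by (intro quarter_fits_upper_triangle) (simp_all only: of_nat_less_iff)
  moreover have "finite {(s, t). 2 \<le> s \<and> s < t \<and> t \<le> k}"
    by (rule finite_subset[of _ "{..k} \<times> {..k}"]) auto
  ultimately obtain \<phi> where \<phi>: "\<phi> ` B \<subseteq> {(s, t). 2 \<le> s \<and> s < t \<and> t \<le> k}" "inj_on \<phi> B"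
    using card_le_inj[OF \<open>finite B\<close>] by blast
  have xsM: "xs ! m \<in> M" if "m < length xs" for m
    using xs(1) that by (auto simp: generating_families_def)
  have z: "(fst \<circ> snd) \<beta> \<in> {1..k} \<and> (snd \<circ> snd) \<beta> \<in> {1..k} \<and> z \<beta> \<in> M \<and>
      p ((fst \<circ> snd) \<beta>) o\<^sub>L z \<beta> = z \<beta> \<and> z \<beta> o\<^sub>L p ((snd \<circ> snd) \<beta>) = z \<beta>" if "\<beta> \<in> B" for \<beta>
  proof -
    obtain m i j where \<beta>: "\<beta> = (m, i, j)"
      by (cases \<beta>)
    then have mem: "m < length xs" "i \<in> {1..k}" "j \<in> {1..k}"
      using that by (auto simp: B_def)
    have "p i o\<^sub>L (p i o\<^sub>L xs ! m o\<^sub>L p j) = p i o\<^sub>L xs ! m o\<^sub>L p j"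
      using p_idem[OF mem(2)] by (simp flip: blinfun_compose_assoc)
    moreover have "(p i o\<^sub>L xs ! m o\<^sub>L p j) o\<^sub>L p j = p i o\<^sub>L xs ! m o\<^sub>L p j"
      using p_idem[OF mem(3)] by (simp add: blinfun_compose_assoc)
    ultimately show ?thesis
      using mem p_closed xsM by (simp add: \<beta> z_def)
  qed
  have "1 \<le> k" "c 1 = p 1"
    using k(1) by (auto simp: c_def)
  then have "\<exists>a\<in>M. \<exists>b\<in>M. self_adjoint a \<and> self_adjoint b \<and>
    (\<forall>N. von_neumann_algebra N \<and> a \<in> N \<and> b \<in> N \<longrightarrow> z ` B \<subseteq> N)"
    by (rule blocks_from_two_self_adjoints[OF _ _ c z \<phi>(2,1)])
  then obtain a b where ab: "a \<in> M" "b \<in> M" "self_adjoint a" "self_adjoint b"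
    and blocks: "\<forall>N. von_neumann_algebra N \<and> a \<in> N \<and> b \<in> N \<longrightarrow> z ` B \<subseteq> N"
    by (elim bexE conjE)
  have generators: "set xs \<subseteq> N" if N: "von_neumann_algebra N" "a \<in> N" "b \<in> N" for N
  proof
    interpret N: von_neumann N
      by unfold_locales (rule N)
    fix x assume "x \<in> set xs"
    then obtain m where m: "m < length xs" "x = xs ! m"
      by (metis in_set_conv_nth)
    have "p i o\<^sub>L x o\<^sub>L p j \<in> N" if "i \<in> {1..k}" "j \<in> {1..k}" for i j
    proof (cases "p i o\<^sub>L x o\<^sub>L p j = 0")
      case False
      then have "(m, i, j) \<in> B"
        using m that by (simp add: B_def)
      then have "z (m, i, j) \<in> N"
        using blocks N by (meson image_eqI subsetD)
      then show ?thesis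
        by (simp add: z_def m)
    qed simp
    then have "(\<Sum>i\<in>{1..k}. \<Sum>j\<in>{1..k}. p i o\<^sub>L x o\<^sub>L p j) \<in> N"
      by (intro N.sum_closed)
    then show "x \<in> N"
      by (simp only: block_decomposition)
  qed
  have "vn_generated {a, b} = M"
  proof
    show "vn_generated {a, b} \<subseteq> M"
      unfolding vn_generated_def using vN ab by blast
    have "vn_generated (set xs) \<subseteq> vn_generated {a, b}"
      unfolding vn_generated_def using generators by blast
    then show "M \<subseteq> vn_generated {a, b}"
      using xs(1) by (simp add: generating_families_def)
  qed
  with ab show ?thesis
    unfolding singly_generated_def by blast
qed

end
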